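(* Let $q=2^k$ be a power of $2$, $F=\mathbb{F}_q$, $G=\mathrm{SL}_2(F)$ acting by conjugation on the space $V$ of trace-zero $2\times 2$ matrices over $F$, $R=S(V^* )=F[x_1,x_2,x_3]$, and $\Omega=R\otimes\Lambda(V^* )$, with $f_1,f_2,f_3\in R^G$ and $\omega\in\Omega^1$ as defined in the context. (a) Suppose $q>2$. Then $\Omega^G$ is a free $R^G$-module, freely generated by $$1,\quad \mathrm{d}f_1,\ \mathrm{d}f_2,\ \omega,\quad f_2^{-1}\,\mathrm{d}f_1\wedge \mathrm{d}f_2,\ f_2^{-1}\,\mathrm{d}f_1\wedge\omega,\ f_2^{-1}\,\mathrm{d}f_2\wedge\omega,\quad \mathrm{d}x_1\wedge \mathrm{d}x_2\wedge \mathrm{d}x_3 .$$ (b) Suppose $q=2$. Then $\Omega^G$ is a free $R^G$-module, freely generated by $$1,\quad \mathrm{d}f_1,\ \mathrm{d}f_2,\ \mathrm{d}f_3,\quad f_2^{-1}\,\mathrm{d}f_1\wedge \mathrm{d}f_2,\ \mathrm{d}f_1\wedge \mathrm{d}f_3,\ \mathrm{d}f_2\wedge \mathrm{d}f_3,\quad \mathrm{d}x_1\wedge \mathrm{d}x_2\wedge \mathrm{d}x_3 .$$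
   Context: Let $F=\mathbb{F}_q$, let $V$ be the $F$-vector space of $2\times 2$ matrices of trace zero, with basis $v_1=\begin{pmatrix}0&-1\\0&0\end{pmatrix}$, $v_2=\begin{pmatrix}1&0\\0&-1\end{pmatrix}$, $v_3=\begin{pmatrix}0&0\\1&0\end{pmatrix}$, and let $x_1,x_2,x_3$ be the dual basis of $V^*$. $\mathrm{SL}_2(F)$ acts on $V$ by $g\cdot v=gvg^{-1}$ with kernel $\{\pm I\}$; $G=\mathrm{SL}_2(F)/\{\pm I\}$, which is $\mathrm{SL}_2(F)$ when $q$ is even. $G$ acts on $V^*$ by $(g\cdot f)(v)=f(g^{-1}\cdot v)$, and on $R=S(V^* )=F[x_1,x_2,x_3]$ by algebra automorphisms; $R^G$ is the ring of invariants. $\Omega=\bigoplus_{i=0}^3\Omega^i$ with $\Omega^i=R\otimes\Lambda^i(V^* )$ is the algebra of differential forms, with the exterior product extended $R$-linearly, and the diagonal $G$-action $g\cdot(f\otimes w)=(g\cdot f)\otimes(g\cdot w)$. The $R$-basis of $\Omega^1$ corresponding to $x_1,x_2,x_3$ is written $\mathrm{d}x_1,\mathrm{d}x_2,\mathrm{d}x_3$, and for $f\in R$, $\mathrm{d}f=\sum_j \frac{\partial f}{\partial x_j}\mathrm{d}x_j$. $\Omega^G$ is the algebra of $G$-fixed points. Polynomials: $f_1=x_1x_3-x_2^2$; $f_2=x_1^qx_3+x_1x_3^q-2x_2^{q+1}$ (so $f_2=x_1^qx_3+x_1x_3^q$ for $q$ even). Fix an irreducible quadratic $g(x)=x^2-\gamma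 x-\delta\in F[x]$ and let $$\tilde f_3=\prod_{\alpha\in F,\ \beta\in F^*}\left(x_1-\frac{2\alpha-\gamma}{\beta}x_2+\frac{g(\alpha)}{\beta^2}x_3\right);$$ $f_3\in R^G$ is the element with $f_3^2=\tilde f_3$ (it is known that such an element exists), of degree $\frac12q(q-1)$. For $q$ even, $$\omega=(x_2^qx_3+x_2x_3^q)\,\mathrm{d}x_1+(x_1^qx_3+x_1x_3^q)\,\mathrm{d}x_2+(x_1^qx_2+x_1x_2^q)\,\mathrm{d}x_3\in\Omega^1 .$$ For $\eta\in\Omega$, $f_2^{-1}\eta$ denotes the unique $\xi\in\Omega$ with $f_2\xi=\eta$ (that the forms so written are divisible by $f_2$ in $\Omega$ is part of the assertion). *)

theory Defs
  imports "HOL-Analysis.Analysis" "HOL-Computational_Algebra.Polynomial"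
begin

section \<open>The polynomial ring in three variables\<close>

text \<open>
  The ring \<open>R = F[x\<^sub>1, x\<^sub>2, x\<^sub>3]\<close> is the iterated polynomial ring \<open>F[x\<^sub>1][x\<^sub>2][x\<^sub>3]\<close>:
  the outermost variable is \<open>x\<^sub>3\<close> and the innermost one is \<open>x\<^sub>1\<close>.
  Variables are indexed by the type \<open>3\<close>, whose elements are written \<open>1, 2, 3\<close> (with \<open>3 = 0\<close>).
\<close>

type_synonym 'a poly3 = "'a poly poly poly"

definition cst :: "'a::field \<Rightarrow> 'a poly3" where
  "cst c = [:[:[:c:]:]:]"

definition var :: "3 \<Rightarrow> 'a::field poly3" where
  "var i = (if i = 1 then [:[:[:0, 1:]:]:] else if i = 2 then [:[:0, 1:]:] else [:0, 1:])"

definition partial :: "3 \<Rightarrow> 'a::field poly3 \<Rightarrow> 'a poly3" where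
  "partial i f = (if i = 1 then map_poly (map_poly pderiv) f
                  else if i = 2 then map_poly pderiv f else pderiv f)"

text \<open>The \<open>F\<close>-algebra endomorphism of \<open>R\<close> that sends each \<open>x\<^sub>i\<close> to \<open>y i\<close>.\<close>

definition subst_poly :: "(3 \<Rightarrow> 'a::field poly3) \<Rightarrow> 'a poly3 \<Rightarrow> 'a poly3" where
  "subst_poly y f =
     poly (map_poly (\<lambda>p. poly (map_poly (\<lambda>r. poly (map_poly cst r) (y 1)) p) (y 2)) f) (y 3)"

lemma poly_map_poly_hom:
  fixes h :: "'a::comm_ring_1 \<Rightarrow> 'b::comm_ring_1"
  assumes "h 0 = 0" "\<And>a b. h (a + b) = h a + h b" "\<And>a b. h (a * b) = h a * h b"
  shows "poly (map_poly h (p + r)) y = poly (map_poly h p) y + poly (map_poly h r) y"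
    "poly (map_poly h (p * r)) y = poly (map_poly h p) y * poly (map_poly h r) y"
proof -
  have A: "poly (map_poly h (p + r)) y = poly (map_poly h p) y + poly (map_poly h r) y" for p r
  proof (induction p arbitrary: r)
    case (pCons a p)
    show ?case by (cases r) (simp_all add: map_poly_pCons assms pCons.IH distrib_left)
  qed simp
  have S: "poly (map_poly h (smult a r)) y = h a * poly (map_poly h r) y" for a r
    by (induction r) (auto simp: map_poly_pCons assms algebra_simps)
  show "poly (map_poly h (p + r)) y = poly (map_poly h p) y + poly (map_poly h r) y" by (rule A)
  show "poly (map_poly h (p * r)) y = poly (map_poly h p) y * poly (map_poly h r) y"
    by (induction p) (auto simp: map_poly_pCons assms A S algebra_simps)
qed

lemma subst_poly_hom:
  "subst_poly y (f + g) = subst_poly y f + subst_poly y g"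
  "subst_poly y (f * g) = subst_poly y f * subst_poly y g"
  unfolding subst_poly_def
  by (rule poly_map_poly_hom; (simp add: poly_map_poly_hom cst_def)?)+

lemma subst_poly_cst [simp]: "subst_poly y (cst c) = cst c"
  by (simp add: subst_poly_def cst_def map_poly_pCons)

lemma subst_poly_var [simp]: "subst_poly y (var i) = y i"
proof -
  have "i = 1 \<or> i = 2 \<or> i = 3" by (rule exhaust_3)
  then show ?thesis
    by (auto simp: subst_poly_def var_def cst_def map_poly_pCons simp flip: one_pCons)
qed


section \<open>The group and its action on forms of degree one\<close>

definition SL2 :: "('a::field^2^2) set" where
  "SL2 = {g. det g = 1}"

definition trace_zero :: "('a::field^2^2) set" where
  "trace_zero = {A. trace A = 0}"

definition vbasis :: "3 \<Rightarrow> 'a::field^2^2" where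
  "vbasis i = (if i = 1 then vector [vector [0, -1], vector [0, 0]]
               else if i = 2 then vector [vector [1, 0], vector [0, -1]]
               else vector [vector [0, 0], vector [1, 0]])"

text \<open>The dual basis: the coordinates of a matrix in \<open>trace_zero\<close> with respect to \<open>vbasis\<close>.\<close>

definition coord :: "3 \<Rightarrow> 'a::field^2^2 \<Rightarrow> 'a" where
  "coord i A = (if i = 1 then - (A $ 1 $ 2) else if i = 2 then A $ 1 $ 1 else A $ 2 $ 1)"

lemma vbasis_in_trace_zero: "vbasis i \<in> trace_zero"
  by (simp add: vbasis_def trace_zero_def trace_def sum_2)

lemma coord_vbasis: "coord i (vbasis j) = (if i = j then 1 else 0)"
  using exhaust_3[of i] exhaust_3[of j] by (auto simp: coord_def vbasis_def)

lemma trace_zero_expand: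
  assumes "A \<in> trace_zero"
  shows "A = (\<Sum>i\<in>UNIV. mat (coord i A) ** vbasis i)"
  using assms
  by (simp add: vec_eq_iff forall_2 sum_3 sum_2 coord_def vbasis_def matrix_matrix_mult_def
      mat_def trace_zero_def trace_def eq_neg_iff_add_eq_0 add.commute)

definition conj_act :: "'a::field^2^2 \<Rightarrow> 'a^2^2 \<Rightarrow> 'a^2^2" where
  "conj_act g v = g ** v ** matrix_inv g"

text \<open>
  Since \<open>(g \<cdot> x\<^sub>i)(v) = x\<^sub>i(g\<inverse> \<cdot> v)\<close>, one has \<open>g \<cdot> x\<^sub>i = (\<Sum>j. dual_coeff g i j * x\<^sub>j)\<close>.
\<close>

definition dual_coeff :: "'a::field^2^2 \<Rightarrow> 3 \<Rightarrow> 3 \<Rightarrow> 'a" where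
  "dual_coeff g i j = coord i (conj_act (matrix_inv g) (vbasis j))"

definition act_poly :: "'a::field^2^2 \<Rightarrow> 'a poly3 \<Rightarrow> 'a poly3" where
  "act_poly g = subst_poly (\<lambda>i. \<Sum>j\<in>UNIV. cst (dual_coeff g i j) * var j)"

definition invariant_ring :: "'a::field poly3 set" where
  "invariant_ring = {f. \<forall>g\<in>SL2. act_poly g f = f}"


section \<open>Differential forms\<close>

text \<open>
  \<open>\<Omega>\<close> is the free \<open>R\<close>-module on the elements \<open>dx\<^sub>I = dx\<^bsub>i\<^sub>1\<^esub> \<and> \<dots> \<and> dx\<^bsub>i\<^sub>r\<^esub>\<close>, where
  \<open>I = {i\<^sub>1 < \<dots> < i\<^sub>r}\<close> runs over all sets of indices; \<open>\<eta> $ I\<close> is the coefficient of \<open>dx\<^sub>I\<close>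
  in \<open>\<eta>\<close>. The order of the type \<open>3\<close> is \<open>3 < 1 < 2\<close>; another order would only
  change the signs of the basis elements \<open>dx\<^sub>I\<close>.
  The sign in \<open>wedge\<close> is the one in \<open>dx\<^sub>I \<and> dx\<^sub>J = \<plusminus> dx\<^bsub>I \<union> J\<^esub>\<close>, for \<open>I\<close> and \<open>J\<close> disjoint.
  Scalar multiplication by elements of \<open>R\<close> is \<open>*s\<close>; the componentwise
  multiplication \<open>*\<close> of vectors plays no role.
\<close>

lemma less_3: "(3::3) < 1" "(1::3) < 2"
  by (simp_all only: less_bit1_def bit1.Rep_numeral bit1.Rep_1) simp_all

type_synonym 'a form = "('a poly3, 3 set) vec"

definition wedge :: "'a::field form \<Rightarrow> 'a form \<Rightarrow> 'a form" (infixr \<open>\<and>\<^sub>f\<close> 75) where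
  "\<eta> \<and>\<^sub>f \<theta> = (\<chi> K. \<Sum>I\<in>Pow K.
      (- 1) ^ card {(i, j). i \<in> I \<and> j \<in> K - I \<and> j < i} * (\<eta> $ I) * (\<theta> $ (K - I)))"

definition one_form :: "'a::field form" where
  "one_form = axis {} 1"

definition dx :: "3 \<Rightarrow> 'a::field form" where
  "dx i = axis {i} 1"

definition differential :: "'a::field poly3 \<Rightarrow> 'a form" where
  "differential f = (\<Sum>j\<in>UNIV. partial j f *s dx j)"

text \<open>The diagonal action: \<open>g \<cdot> (f dx\<^sub>I) = (g \<cdot> f) (g \<cdot> dx\<^bsub>i\<^sub>1\<^esub>) \<and> \<dots> \<and> (g \<cdot> dx\<^bsub>i\<^sub>r\<^esub>)\<close>.\<close>

definition act_dx :: "'a::field^2^2 \<Rightarrow> 3 \<Rightarrow> 'a form" where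
  "act_dx g i = (\<Sum>j\<in>UNIV. cst (dual_coeff g i j) *s dx j)"

definition act_form :: "'a::field^2^2 \<Rightarrow> 'a form \<Rightarrow> 'a form" where
  "act_form g \<eta> = (\<Sum>I\<in>UNIV. act_poly g (\<eta> $ I) *s
      foldr (\<lambda>i. wedge (act_dx g i)) (sorted_list_of_set I) one_form)"

definition invariant_forms :: "'a::field form set" where
  "invariant_forms = {\<eta>. \<forall>g\<in>SL2. act_form g \<eta> = \<eta>}"

definition form_quotient :: "'a::field poly3 \<Rightarrow> 'a form \<Rightarrow> 'a form" where
  "form_quotient f \<eta> = (THE \<xi>. f *s \<xi> = \<eta>)"


section \<open>Free modules over a subring\<close>

text \<open>
  \<open>M\<close> is a module over the subring \<open>S\<close>, freely generated by the family \<open>bs\<close>.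
\<close>

definition freely_generated :: "'r::comm_ring_1 set \<Rightarrow> ('r^'n) set \<Rightarrow> ('r^'n) list \<Rightarrow> bool" where
  "freely_generated S M bs \<longleftrightarrow>
     0 \<in> M \<and> (\<forall>x\<in>M. \<forall>y\<in>M. x + y \<in> M) \<and> (\<forall>c\<in>S. \<forall>x\<in>M. c *s x \<in> M) \<and>
     set bs \<subseteq> M \<and>
     (\<forall>x\<in>M. \<exists>!cs. length cs = length bs \<and> set cs \<subseteq> S \<and> x = (\<Sum>i<length bs. (cs ! i) *s (bs ! i)))"


section \<open>The polynomials and the form of the theorem\<close>

definition f1 :: "'a::field poly3" where
  "f1 = var 1 * var 3 - var 2 ^ 2"

definition f2 :: "'a::{field,finite} poly3" where
  "f2 = (let q = CARD('a) in
     var 1 ^ q * var 3 + var 1 * var 3 ^ q - 2 * var 2 ^ (q + 1))"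

text \<open>In the next two definitions the fixed irreducible quadratic is \<open>x\<^sup>2 - \<gamma> x - \<delta>\<close>.\<close>

definition f3_tilde :: "'a::{field,finite} \<Rightarrow> 'a \<Rightarrow> 'a poly3" where
  "f3_tilde \<gamma> \<delta> = (\<Prod>\<alpha>\<in>UNIV. \<Prod>\<beta>\<in>UNIV - {0}.
     var 1 - cst ((2 * \<alpha> - \<gamma>) / \<beta>) * var 2 + cst (poly [:- \<delta>, - \<gamma>, 1:] \<alpha> / \<beta>\<^sup>2) * var 3)"

text \<open>In characteristic two a square root in \<open>R\<close> is unique if it exists.\<close>

definition f3 :: "'a::{field,finite} \<Rightarrow> 'a \<Rightarrow> 'a poly3" where
  "f3 \<gamma> \<delta> = (THE f. f \<in> invariant_ring \<and> f\<^sup>2 = f3_tilde \<gamma> \<delta>)"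

definition omega :: "'a::{field,finite} form" where
  "omega = (let q = CARD('a) in
     (var 2 ^ q * var 3 + var 2 * var 3 ^ q) *s dx 1 +
     (var 1 ^ q * var 3 + var 1 * var 3 ^ q) *s dx 2 +
     (var 1 ^ q * var 2 + var 1 * var 2 ^ q) *s dx 3)"

end

theory Submission
  imports Defs
begin

text \<open>
  In characteristic two, \<open>x\<^sub>1\<close> and \<open>x\<^sub>3\<close> span a submodule of \<open>V\<^sup>*\<close>, and \<open>f\<^sub>2\<close> is a product of
  \<open>q + 1\<close> linear forms, one on each of its lines. The group permutes these lines transitively,
  so an invariant polynomial divisible by \<open>x\<^sub>3\<close> is divisible by \<open>f\<^sub>2\<close>. The transvections fixing
  \<open>x\<^sub>3\<close> force certain coefficients of an invariant form to be divisible by \<open>x\<^sub>3\<close>: for 2-forms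
  that of \<open>dx\<^sub>1 \<and> dx\<^sub>2\<close>; for 1-forms that of \<open>dx\<^sub>1\<close>, once the coefficient of \<open>dx\<^sub>2\<close> has been
  removed, and, if \<open>q > 2\<close>, also that of \<open>dx\<^sub>2\<close>. Cramer's rule expresses the coordinates of the
  form in the claimed basis as quotients by \<open>f\<^sub>2\<close> of invariants divisible by \<open>x\<^sub>3\<close>, so they are
  invariant polynomials.
\<close>

section \<open>Polynomials in three variables\<close>

lemma cst_hom [simp]:
  "cst 0 = 0" "cst 1 = 1" "cst (a + b) = cst a + cst b" "cst (a * b) = cst a * cst b"
  "cst (- a) = - cst a" "cst (a - b) = cst a - cst b"
  by (simp_all add: cst_def one_pCons)

lemma cst_power [simp]: "cst (a ^ n) = cst a ^ n"
  by (induction n) simp_all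

lemma cst_eq_iff [simp]: "cst a = cst b \<longleftrightarrow> a = b"
  by (simp add: cst_def)

text \<open>Constants and variables generate the algebra: in each layer of the iterated polynomial
  ring, \<open>pCons c p\<close> is \<open>c\<close> plus the variable times
  \<open>p\<close>.\<close>

lemma poly3_induct [case_names cst var add mult]:
  fixes f :: "'a::field poly3"
  assumes cst: "\<And>c. P (cst c)" and var: "\<And>i. P (var i)"
    and add: "\<And>f g. P f \<Longrightarrow> P g \<Longrightarrow> P (f + g)" and mult: "\<And>f g. P f \<Longrightarrow> P g \<Longrightarrow> P (f * g)"
  shows "P f"
proof -
  have zero: "P 0"
    using cst[of 0] by simp
  have 1: "P [:[:p:]:]" for p
  proof (induction p)
    case (pCons c p)
    have "[:[:pCons c p:]:] = cst c + var 1 * [:[:p:]:]"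
      by (simp add: cst_def var_def)
    then show ?case
      using add cst var mult pCons by presburger
  qed (simp add: zero)
  have 2: "P [:p:]" for p
  proof (induction p)
    case (pCons c p)
    have "[:pCons c p:] = [:[:c:]:] + var 2 * [:p:]"
      by (simp add: var_def)
    then show ?case
      using add 1 var mult pCons by presburger
  qed (simp add: zero)
  show ?thesis
  proof (induction f)
    case (pCons c p)
    have "pCons c p = [:c:] + var 3 * p"
      by (simp add: var_def)
    then show ?case
      using add 2 var mult pCons by presburger
  qed (simp add: zero)
qed

lemma var_neq_0 [simp]: "var i \<noteq> 0"
  by (simp add: var_def)

lemma subst_poly_const [simp]: "subst_poly y 0 = 0" "subst_poly y 1 = 1"
  using subst_poly_cst[of y 0] subst_poly_cst[of y 1] by simp_all

lemma subst_poly_power: "subst_poly y (f ^ n) = subst_poly y f ^ n"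
  by (induction n) (simp_all add: subst_poly_hom)

lemma subst_poly_id: "subst_poly var f = f"
  by (induction f rule: poly3_induct) (simp_all add: subst_poly_hom)

text \<open>Followed by reduction modulo \<open>m\<close>, both substitutions become the same
  homomorphism, because they agree on the variables.\<close>

lemma dvd_subst_poly_diff:
  assumes "\<And>i. m dvd y i - z i"
  shows "m dvd subst_poly y f - subst_poly z f"
proof (induction f rule: poly3_induct)
  case (add f g)
  have "subst_poly y (f + g) - subst_poly z (f + g)
    = (subst_poly y f - subst_poly z f) + (subst_poly y g - subst_poly z g)"
    by (simp add: subst_poly_hom)
  then show ?case
    using add by simp
next
  case (mult f g)
  have "subst_poly y (f * g) - subst_poly z (f * g)
    = (subst_poly y f - subst_poly z f) * subst_poly y g
      + subst_poly z f * (subst_poly y g - subst_poly z g)"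
    by (simp add: subst_poly_hom algebra_simps)
  then show ?case
    using mult by simp
qed (use assms in simp_all)

text \<open>A prime that divides \<open>prod p S * k\<close> but no factor of the product divides
  the cofactor \<open>k\<close>, so the primes can be split off one at a time. This works in any
  integral domain, without unique factorization.\<close>

lemma prod_dvd_of_prime_elem:
  fixes h :: "'a::idom"
  assumes "finite S" "\<And>i. i \<in> S \<Longrightarrow> p i dvd h" "\<And>i. i \<in> S \<Longrightarrow> prime_elem (p i)"
    and "\<And>i j. i \<in> S \<Longrightarrow> j \<in> S \<Longrightarrow> p i dvd p j \<Longrightarrow> i = j"
  shows "prod p S dvd h"
  using assms
proof (induction S rule: finite_induct)
  case (insert i S)
  have "prod p S dvd h"
    using insert by auto
  then obtain k where k: "h = prod p S * k"
    by blast
  \<comment> \<open>A prime dividing the product would divide one of its factors; the induction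
    starts because a prime is not a unit.\<close>
  have "\<not> p i dvd prod p T" if "finite T" "T \<subseteq> S" for T
    using that
  proof induction
    case empty
    then show ?case
      using insert.prems(2)[of i] by (simp add: prime_elem_def)
  next
    case (insert j T)
    moreover have "\<not> p i dvd p j"
      using insert.prems \<open>i \<notin> S\<close> \<open>\<And>i' j. i' \<in> insert i S \<Longrightarrow> j \<in> insert i S \<Longrightarrow> p i' dvd p j \<Longrightarrow> i' = j\<close>
      by blast
    ultimately show ?case
      using \<open>\<And>i'. i' \<in> insert i S \<Longrightarrow> prime_elem (p i')\<close> by (simp add: prime_elem_dvd_mult_iff)
  qed
  then have "p i dvd k"
    using insert.prems(1,2)[of i] insert.hyps(1) k by (auto simp: prime_elem_dvd_mult_iff)
  then show ?case
    using insert.hyps k by (simp add: mult.commute mult_dvd_mono)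
qed simp

text \<open>The substitution kills \<open>l\<close> and is the identity modulo \<open>l\<close>, so
  its kernel is the ideal generated by \<open>l\<close>. Divisibility by a linear form thus becomes
  the vanishing of a substitution.\<close>

lemma dvd_subst_poly_eq_0:
  fixes l :: "'a::field poly3"
  assumes l: "subst_poly y l = 0" and y: "\<And>i. l dvd var i - y i"
  shows "l dvd f \<longleftrightarrow> subst_poly y f = 0"
proof
  assume "l dvd f"
  then show "subst_poly y f = 0"
    using l by (auto simp: dvd_def subst_poly_hom)
next
  assume "subst_poly y f = 0"
  then show "l dvd f"
    using dvd_subst_poly_diff[of l var y f] y by (simp add: subst_poly_id)
qed

section \<open>Linear forms over a finite field\<close>

text \<open>Multiplication by a nonzero \<open>x\<close> permutes the nonzero elements; comparing
  the products over them shows that the power with exponent q - 1 is 1.\<close>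

lemma finite_field_power_CARD:
  fixes x :: "'a::{field,finite}"
  shows "x ^ CARD('a) = x"
proof (cases "x = 0")
  case False
  have "(\<Prod>y\<in>UNIV - {0}. x * y) = (\<Prod>y\<in>UNIV - {0}. y)"
    by (rule prod.reindex_bij_witness[of _ "\<lambda>y. y / x" "\<lambda>y. x * y"]) (use False in auto)
  then have "x ^ (CARD('a) - 1) = 1"
    by (simp add: prod.distrib card_Diff_singleton)
  then show ?thesis
    by (simp add: power_eq_if)
qed simp

text \<open>Translation by 1 permutes the ring; compare the sums over all elements.\<close>

lemma of_nat_CARD_eq_0: "of_nat CARD('a) = (0 :: 'a::{ring_1,finite})"
proof -
  have "(\<Sum>y\<in>UNIV. y + 1) = (\<Sum>y\<in>(UNIV::'a set). y)"
    by (rule sum.reindex_bij_witness[of _ "\<lambda>y. y - 1" "\<lambda>y. y + 1"]) auto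
  then show ?thesis
    by (simp add: sum.distrib)
qed

text \<open>As polynomials in a new variable T over R, the product of the T - e y and T^q - y^(q-1)
  T are monic of degree q and agree at the q points e y, which are distinct for y nonzero.
  Evaluation at T = x and multiplication by y give the identity.\<close>

lemma prod_linear_forms:
  fixes x y :: "'a::{field,finite} poly3"
  shows "y * (\<Prod>e\<in>UNIV. x - cst e * y) = x ^ CARD('a) * y - x * y ^ CARD('a)"
proof (cases "y = 0")
  case False
  let ?q = "CARD('a)"
  let ?p = "\<Prod>e\<in>UNIV. [:- (cst e * y), 1:]"
  let ?r = "monom 1 ?q - monom (y ^ (?q - 1)) 1"
  have q: "?q > 1"
    using card_mono[of "UNIV::'a set" "{0, 1}"] by simp
  have "degree ?p = ?q" and "lead_coeff ?p = 1"
    by (subst degree_prod_eq_sum_degree; simp) (simp add: lead_coeff_prod)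
  moreover have "poly.coeff ?r ?q = 1"
    using q by (simp add: coeff_monom)
  moreover have "inj_on (\<lambda>e. cst e * y) (UNIV::'a set)"
    using False by (auto intro: inj_onI)
  then have "card (range (\<lambda>e. cst e * y)) = ?q"
    by (simp add: card_image)
  moreover have "degree ?r \<le> ?q"
    using q by (intro degree_diff_le degree_monom_le order.trans[OF degree_monom_le]) auto
  moreover have "poly ?p z = poly ?r z" if "z \<in> range (\<lambda>e. cst e * y)" for z
  proof -
    obtain e where z: "z = cst e * y"
      using \<open>z \<in> range _\<close> by blast
    have "poly ?p z = 0"
      by (auto simp: poly_prod z)
    moreover have "poly ?r z = cst (e ^ ?q) * (y ^ (?q - 1) * y) - y ^ (?q - 1) * (cst e * y)"
      using q by (simp add: z poly_monom power_mult_distrib flip: power_Suc2)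
    ultimately show ?thesis
      by (simp only: finite_field_power_CARD) simp
  qed
  ultimately have "?p = ?r"
    by (intro poly_eqI_degree_lead_coeff[where n = ?q and A = "range (\<lambda>e. cst e * y)"]) auto
  then have "poly ?p x = poly ?r x"
    by simp
  then have "(\<Prod>e\<in>UNIV. x - cst e * y) = x ^ ?q - y ^ (?q - 1) * x"
    by (simp add: poly_prod poly_monom)
  then have "y * (\<Prod>e\<in>UNIV. x - cst e * y) = x ^ ?q * y - x * (y ^ (?q - 1) * y)"
    by (simp only: right_diff_distrib mult_ac)
  also have "y ^ (?q - 1) * y = y ^ ?q"
    using q by (simp flip: power_Suc2)
  finally show ?thesis .
qed (simp add: zero_power)

text \<open>The linear forms correspond to the points of the projective line over F, with
  \<open>None\<close> for the point at infinity. They are primes, none of which divides another, so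
  their product divides \<open>h\<close>.\<close>

lemma dvd_of_linear_forms_dvd:
  fixes h :: "'a::{field,finite} poly3"
  assumes h3: "var 3 dvd h" and h1: "\<And>e. var 1 - cst e * var 3 dvd h"
  shows "var 1 ^ CARD('a) * var 3 - var 1 * var 3 ^ CARD('a) dvd h"
proof -
  define l :: "'a option \<Rightarrow> 'a poly3"
    where "l i = (case i of None \<Rightarrow> var 3 | Some e \<Rightarrow> var 1 - cst e * var 3)" for i
  \<comment> \<open>The substitution \<open>y i\<close> eliminates one variable by means of the
    equation \<open>l i = 0\<close>.\<close>
  define y :: "'a option \<Rightarrow> 3 \<Rightarrow> 'a poly3"
    where "y i = (case i of None \<Rightarrow> var(3 := 0) | Some e \<Rightarrow> var(1 := cst e * var 3))" for i
  have subst_diff: "subst_poly z (f - g) = subst_poly z f - subst_poly z g" for z and f g :: "'a poly3"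
    by (metis add_diff_cancel_right' diff_add_cancel subst_poly_hom(1))
  have dvd_iff: "l i dvd f \<longleftrightarrow> subst_poly (y i) f = 0" for i f
    by (rule dvd_subst_poly_eq_0) (auto simp: l_def y_def subst_diff subst_poly_hom split: option.split)
  have "(var 1 :: 'a poly3) \<noteq> cst e * var 3" for e
    by (simp add: var_def cst_def)
  \<comment> \<open>Through \<open>dvd_iff\<close>, primality of \<open>l i\<close> says that
    \<open>l i\<close> is nonzero, that \<open>y i\<close> does not kill 1, and that R has no zero
    divisors.\<close>
  then have "prime_elem (l i)" for i
    unfolding prime_elem_def dvd_iff by (auto simp: subst_poly_hom l_def split: option.split)
  moreover have "l i dvd l j \<Longrightarrow> i = j" for i j
    unfolding dvd_iff by (auto simp: y_def l_def subst_diff subst_poly_hom split: option.splits)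
  moreover have "l i dvd h" for i
    using assms by (simp add: l_def split: option.split)
  ultimately have "prod l UNIV dvd h"
    by (intro prod_dvd_of_prime_elem) auto
  also have "prod l UNIV = var 3 * (\<Prod>e\<in>UNIV. var 1 - cst e * var 3)"
    by (simp add: UNIV_option_conv l_def prod.reindex)
  finally show ?thesis
    by (simp add: prod_linear_forms)
qed

section \<open>The action on polynomials and on forms\<close>

lemma matrix_inv_eq:
  fixes A :: "'b::field^'n^'n"
  assumes AB: "A ** B = mat 1" and BA: "B ** A = mat 1"
  shows "matrix_inv A = B"
  unfolding matrix_inv_def
proof (rule some_equality)
  fix C
  assume "A ** C = mat 1 \<and> C ** A = mat 1"
  then show "C = B"
    by (metis BA matrix_mul_assoc matrix_mul_lid matrix_mul_rid)
qed (use assms in simp)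

text \<open>For determinant one the adjugate is a two-sided inverse. The double inverse arises
  because \<open>dual_coeff\<close> lets the inverse of \<open>g\<close> act by conjugation.\<close>

lemma matrix_inv_SL2:
  fixes g :: "'b::field^2^2"
  assumes "g \<in> SL2"
  shows "matrix_inv g = vector [vector [g$2$2, - g$1$2], vector [- g$2$1, g$1$1]]"
    "matrix_inv (matrix_inv g) = g"
proof -
  let ?h = "vector [vector [g$2$2, - g$1$2], vector [- g$2$1, g$1$1]] :: 'b^2^2"
  have "g$1$1 * g$2$2 - g$1$2 * g$2$1 = 1"
    using assms by (simp add: SL2_def det_2)
  then have 1: "g ** ?h = mat 1" "?h ** g = mat 1"
    by (simp_all add: vec_eq_iff forall_2 matrix_matrix_mult_def sum_2 mat_def algebra_simps)
  show inv: "matrix_inv g = ?h"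
    by (intro matrix_inv_eq 1)
  show "matrix_inv (matrix_inv g) = g"
    unfolding inv by (intro matrix_inv_eq 1)
qed

lemma act_poly_hom [simp]:
  "act_poly g (f + h) = act_poly g f + act_poly g h"
  "act_poly g (f * h) = act_poly g f * act_poly g h"
  "act_poly g (f ^ n) = act_poly g f ^ n"
  "act_poly g (cst c) = cst c" "act_poly g 0 = 0" "act_poly g 1 = 1"
  by (simp_all add: act_poly_def subst_poly_hom subst_poly_power)

section \<open>Components of forms, indexed by the eight subsets of the index type\<close>

lemma subsets_3: "UNIV = {{}, {1}, {2}, {3}, {1, 2}, {1, 3}, {2, 3}, {1, 2, 3} :: 3 set}"
proof -
  have "UNIV = Pow (UNIV :: 3 set)"
    by simp
  then show ?thesis
    unfolding UNIV_3 by (simp add: Pow_insert insert_commute Un_commute)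
qed

lemma form_eq_iff:
  "(\<eta> :: 'b::field form) = \<theta> \<longleftrightarrow> \<eta>${} = \<theta>${} \<and> \<eta>${1} = \<theta>${1} \<and> \<eta>${2} = \<theta>${2} \<and> \<eta>${3} = \<theta>${3}
    \<and> \<eta>${1,2} = \<theta>${1,2} \<and> \<eta>${1,3} = \<theta>${1,3} \<and> \<eta>${2,3} = \<theta>${2,3} \<and> \<eta>${1,2,3} = \<theta>${1,2,3}"
proof -
  have "\<eta> = \<theta> \<longleftrightarrow> (\<forall>I\<in>UNIV. \<eta>$I = \<theta>$I)"
    by (simp add: vec_eq_iff)
  then show ?thesis
    unfolding subsets_3 by simp
qed

lemma sum_subsets_3:
  "(\<Sum>I\<in>UNIV. h I) = h {} + h {1} + h {2} + h {3} + h {1,2} + h {1,3} + h {2,3} + h {1,2,3::3}"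
  for h :: "3 set \<Rightarrow> 'b::comm_monoid_add"
  unfolding subsets_3 by (simp add: doubleton_eq_iff insert_eq_iff add_ac)

lemma dx_nth: "dx i $ K = (if K = {i} then 1 else 0)"
  by (auto simp: dx_def axis_def)

lemma one_form_nth: "one_form $ K = (if K = {} then 1 else 0)"
  by (auto simp: one_form_def axis_def)

text \<open>Index 3 comes first, since the numeral \<open>3\<close> is the zero of its type.\<close>

lemma sorted_list_of_subsets_3:
  "sorted_list_of_set {1, 2::3} = [1, 2]" "sorted_list_of_set {1, 3::3} = [3, 1]"
  "sorted_list_of_set {2, 3::3} = [3, 2]" "sorted_list_of_set {1, 2, 3::3} = [3, 1, 2]"
proof -
  have l: "3 < (2::3)"
    using less_3 by (rule less_trans)
  show "sorted_list_of_set {1, 2::3} = [1, 2]" "sorted_list_of_set {1, 3::3} = [3, 1]"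
  "sorted_list_of_set {2, 3::3} = [3, 2]" "sorted_list_of_set {1, 2, 3::3} = [3, 1, 2]"
    using sorted_list_of_set.idem_if_sorted_distinct[of "[1, 2::3]"]
      sorted_list_of_set.idem_if_sorted_distinct[of "[3, 1::3]"]
      sorted_list_of_set.idem_if_sorted_distinct[of "[3, 2::3]"]
        sorted_list_of_set.idem_if_sorted_distinct[of "[3, 1, 2::3]"]
      less_3 l less_imp_le[OF less_3(1)] less_imp_le[OF less_3(2)] less_imp_le[OF l]
    by (simp_all add: insert_commute)
qed

text \<open>A derivation applied coefficientwise is a derivation, by the Leibniz rule in each term
  of the convolution of coefficients. This covers the derivatives in the inner variables.\<close>

lemma map_poly_derivation:
  fixes D :: "'b::comm_ring_1 \<Rightarrow> 'b"
  assumes add: "\<And>a b. D (a + b) = D a + D b" and mult: "\<And>a b. D (a * b) = a * D b + D a * b"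
  shows "map_poly D (p + r) = map_poly D p + map_poly D r"
    "map_poly D (p * r) = p * map_poly D r + map_poly D p * r"
proof -
  have zero [simp]: "D 0 = 0"
    using add[of 0 0] by simp
  have sum: "D (sum h S) = (\<Sum>i\<in>S. D (h i))" for h :: "nat \<Rightarrow> 'b" and S
    by (induction S rule: infinite_finite_induct) (simp_all add: add)
  show "map_poly D (p + r) = map_poly D p + map_poly D r"
    by (rule poly_eqI) (simp add: coeff_map_poly add)
  show "map_poly D (p * r) = p * map_poly D r + map_poly D p * r"
    by (rule poly_eqI) (simp add: coeff_map_poly coeff_mult sum mult sum.distrib)
qed

lemma partial_add: "partial i (f + g) = partial i f + partial i g"
  and partial_mult: "partial i (f * g) = f * partial i g + partial i f * g"
  unfolding partial_def
  by (simp_all add: map_poly_derivation pderiv_add pderiv_mult mult.commute)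

lemma partial_var: "partial i (var j) = (if i = j then 1 else 0)"
  using exhaust_3[of i] exhaust_3[of j]
  by (auto simp: partial_def var_def map_poly_pCons pderiv_pCons one_pCons)

lemma differential_nth: "differential f ${j} = partial j f" "differential f ${} = 0"
  "i \<noteq> j \<Longrightarrow> differential f ${i,j} = 0" "differential f ${1,2,3} = 0"
  using exhaust_3[of j]
  by (auto simp: differential_def sum_3 dx_nth doubleton_eq_iff insert_eq_iff)

lemma act_form_add: "act_form g (\<eta> + \<theta>) = act_form g \<eta> + act_form g \<theta>"
  by (simp add: act_form_def vec.scale_left_distrib sum.distrib)

lemma act_form_scale: "act_form g (c *s \<eta>) = act_poly g c *s act_form g \<eta>"
  by (simp add: act_form_def vec_eq_iff sum_distrib_left mult.assoc)

lemma invariant_forms_add: "\<eta> \<in> invariant_forms \<Longrightarrow> \<theta> \<in> invariant_forms \<Longrightarrow> \<eta> + \<theta> \<in> invariant_forms"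
  and invariant_forms_scale: "c \<in> invariant_ring \<Longrightarrow> \<eta> \<in> invariant_forms \<Longrightarrow> c *s \<eta> \<in> invariant_forms"
  by (simp_all add: invariant_forms_def invariant_ring_def act_form_add act_form_scale)

lemma invariant_ring_cancel:
  assumes "f \<in> invariant_ring" "f * h \<in> invariant_ring" "f \<noteq> 0"
  shows "h \<in> invariant_ring"
  using assms by (auto simp: invariant_ring_def)

text \<open>The contraction of \<open>dx\<^sub>1 \<and> dx\<^sub>2 \<and> dx\<^sub>3\<close> with the vector field \<open>y\<close>, up to signs.\<close>

definition vol_contraction :: "(3 \<Rightarrow> 'a::field poly3) \<Rightarrow> 'a form" where
  "vol_contraction y = y 3 *s (dx 1 \<and>\<^sub>f dx 2) + y 2 *s (dx 1 \<and>\<^sub>f dx 3) + y 1 *s (dx 2 \<and>\<^sub>f dx 3)"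

lemma list_8_conv: "length cs = 8 \<longleftrightarrow> (\<exists>c0 c1 c2 c3 c4 c5 c6 c7. cs = [c0, c1, c2, c3, c4, c5, c6, c7])"
  by (simp add: eval_nat_numeral length_Suc_conv flip: ex_simps)

lemma sum_nth_8:
  "(\<Sum>i<8. ([c0, c1, c2, c3, c4, c5, c6, c7] ! i) *s ([b0, b1, b2, b3, b4, b5, b6, b7] ! i))
   = c0 *s b0 + c1 *s b1 + c2 *s b2 + c3 *s b3 + c4 *s b4 + c5 *s b5 + c6 *s b6 + c7 *s b7"
  by (simp add: eval_nat_numeral)

section \<open>Characteristic two\<close>

context
  fixes k :: nat
  assumes card: "CARD('a::{field,finite}) = 2 ^ k"
begin

text \<open>Since q = 0 in F, a power of 2 vanishes there, hence 2 itself does.\<close>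

lemma CHAR_eq_2: "CHAR('a) = 2"
proof -
  have "(2::'a) ^ k = 0"
    using of_nat_CARD_eq_0[where 'a = 'a] card by simp
  then have "of_nat 2 = (0::'a)"
    by simp
  then have "CHAR('a) dvd 2"
    by (simp only: of_nat_eq_0_iff_char_dvd)
  then have "CHAR('a) \<le> 2" "CHAR('a) \<noteq> 0"
    by (auto intro: dvd_imp_le intro!: Nat.gr0I)
  moreover have "CHAR('a) \<noteq> 1"
    by simp
  ultimately show ?thesis
    by linarith
qed

lemma two_eq_0: "(2::'a) = 0" "(2::'a poly3) = 0"
  using of_nat_CHAR[where 'a = 'a] of_nat_CHAR[where 'a = "'a poly3"] by (simp_all add: CHAR_eq_2)

lemma minus_eq_plus: "a - b = a + (b::'a)" "f - g = f + (g::'a poly3)"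
  by (rule minus_CHAR_2; simp add: CHAR_eq_2)+

lemma uminus_eq: "- a = (a::'a)" "- f = (f::'a poly3)"
  by (rule uminus_CHAR_2; simp add: CHAR_eq_2)+

lemma add_self: "a + a = (0::'a)" "f + f = (0::'a poly3)"
  by (simp_all add: two_eq_0 flip: mult_2)

lemma add_self_left: "a + (a + b) = (b::'a)" "f + (f + g) = (g::'a poly3)"
  by (simp_all add: add_self flip: add.assoc)

text \<open>
  With these rules the simplifier decides polynomial identities over the prime field. An identity that
  depends on \<open>ad + bc = 1\<close> is first homogenised by powers of \<open>ad + bc\<close>, so that it holds formally.
\<close>

lemmas char_2_simps = add_self add_self_left power2_eq_square algebra_simps

lemma power_CARD_add: "(f + g) ^ CARD('a) = f ^ CARD('a) + (g::'a poly3) ^ CARD('a)"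
  by (rule freshmans_dream') (simp_all add: CHAR_eq_2 card)

lemma f2_eq: "(f2 :: 'a poly3) = var 1 ^ CARD('a) * var 3 + var 1 * var 3 ^ CARD('a)"
  by (simp add: f2_def Let_def two_eq_0)

text \<open>Squaring is injective in characteristic two, hence surjective on a finite field.\<close>

lemma square_surj: "\<exists>a. a\<^sup>2 = (e::'a)"
proof -
  have "inj (\<lambda>a::'a. a\<^sup>2)"
  proof (rule injI)
    fix a b :: 'a
    assume "a\<^sup>2 = b\<^sup>2"
    then have "(a + b) * (a + b) = 0"
      by (simp add: power2_eq_square algebra_simps add_self)
    then show "a = b"
      by (metis minus_eq_plus(1) eq_iff_diff_eq_0 mult_eq_0_iff)
  qed
  then have "surj (\<lambda>a::'a. a\<^sup>2)"
    by (simp add: finite_UNIV_inj_surj)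
  then show ?thesis
    by (metis surjD)
qed

text \<open>The two zeros are special to characteristic two: the x_2-coefficients of g x_1 and g x_3
  are multiples of 2. They are the reason why x_1 and x_3 span a submodule.\<close>

lemma dual_coeff_SL2:
  assumes "g \<in> SL2"
  shows "dual_coeff g 1 1 = (g$2$2 :: 'a)\<^sup>2" "dual_coeff g 1 2 = 0" "dual_coeff g 1 3 = (g$1$2)\<^sup>2"
    "dual_coeff g 2 1 = g$2$1 * g$2$2" "dual_coeff g 2 2 = 1" "dual_coeff g 2 3 = g$1$1 * g$1$2"
    "dual_coeff g 3 1 = (g$2$1)\<^sup>2" "dual_coeff g 3 2 = 0" "dual_coeff g 3 3 = (g$1$1)\<^sup>2"
proof -
  have det: "g$1$1 * g$2$2 + g$1$2 * g$2$1 = 1"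
    using assms by (simp add: SL2_def det_2 minus_eq_plus)
  show "dual_coeff g 1 1 = (g$2$2)\<^sup>2" "dual_coeff g 1 2 = 0" "dual_coeff g 1 3 = (g$1$2)\<^sup>2"
    "dual_coeff g 2 1 = g$2$1 * g$2$2" "dual_coeff g 2 2 = 1" "dual_coeff g 2 3 = g$1$1 * g$1$2"
    "dual_coeff g 3 1 = (g$2$1)\<^sup>2" "dual_coeff g 3 2 = 0" "dual_coeff g 3 3 = (g$1$1)\<^sup>2"
    unfolding dual_coeff_def conj_act_def matrix_inv_SL2(2)[OF assms]
    unfolding matrix_inv_SL2(1)[OF assms] using det
    by (simp_all add: coord_def vbasis_def matrix_matrix_mult_def sum_2 uminus_eq power2_eq_square
        mult_ac add_ac add_self)
qed

lemma act_poly_var: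
  fixes g :: "'a^2^2"
  assumes "g \<in> SL2"
  shows "act_poly g (var 1) = (cst (g$2$2))\<^sup>2 * var 1 + (cst (g$1$2))\<^sup>2 * var 3"
    "act_poly g (var 2) = cst (g$2$1) * cst (g$2$2) * var 1 + var 2 + cst (g$1$1) * cst (g$1$2) * var 3"
    "act_poly g (var 3) = (cst (g$2$1))\<^sup>2 * var 1 + (cst (g$1$1))\<^sup>2 * var 3"
  by (simp_all add: act_poly_def sum_3 dual_coeff_SL2[OF assms])

lemma det_cst:
  fixes g :: "'a^2^2"
  assumes "g \<in> SL2"
  shows "cst (g$1$1) * cst (g$2$2) + cst (g$1$2) * cst (g$2$1) = 1"
proof -
  have "g$1$1 * g$2$2 + g$1$2 * g$2$1 = 1"
    using assms by (simp add: SL2_def det_2 minus_eq_plus)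
  then show ?thesis
    by (metis cst_hom(2-4))
qed

text \<open>Raising to the power q is additive and fixes the scalars, so the q-th powers of the
  variables transform by the same matrix as the variables.\<close>

lemma act_poly_var_power_CARD:
  fixes g :: "'a^2^2"
  assumes "g \<in> SL2"
  shows "act_poly g (var 1 ^ CARD('a)) = (cst (g$2$2))\<^sup>2 * var 1 ^ CARD('a)
    + (cst (g$1$2))\<^sup>2 * var 3 ^ CARD('a)"
    "act_poly g (var 2 ^ CARD('a))
     = cst (g$2$1) * cst (g$2$2) * var 1 ^ CARD('a) + var 2 ^ CARD('a)
       + cst (g$1$1) * cst (g$1$2) * var 3 ^ CARD('a)"
    "act_poly g (var 3 ^ CARD('a)) = (cst (g$2$1))\<^sup>2 * var 1 ^ CARD('a)
      + (cst (g$1$1))\<^sup>2 * var 3 ^ CARD('a)"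
proof -
  have "cst c ^ CARD('a) = cst c" for c :: 'a
    by (metis cst_power finite_field_power_CARD)
  then show "act_poly g (var 1 ^ CARD('a)) = (cst (g$2$2))\<^sup>2 * var 1 ^ CARD('a)
    + (cst (g$1$2))\<^sup>2 * var 3 ^ CARD('a)"
    "act_poly g (var 2 ^ CARD('a))
     = cst (g$2$1) * cst (g$2$2) * var 1 ^ CARD('a) + var 2 ^ CARD('a)
       + cst (g$1$1) * cst (g$1$2) * var 3 ^ CARD('a)"
    "act_poly g (var 3 ^ CARD('a)) = (cst (g$2$1))\<^sup>2 * var 1 ^ CARD('a)
      + (cst (g$1$1))\<^sup>2 * var 3 ^ CARD('a)"
    unfolding act_poly_hom(3) act_poly_var[OF assms]
    by (simp_all add: power_CARD_add power_mult_distrib power2_eq_square)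
qed

text \<open>Here \<open>f2\<close> is the determinant of the matrix with rows (x_1, x_3) and their
  q-th powers. Both rows transform by one matrix, whose determinant is the square of ad +
  bc.\<close>

lemma f2_invariant: "(f2 :: 'a poly3) \<in> invariant_ring"
proof -
  have "act_poly g f2 = f2" if g: "g \<in> SL2" for g :: "'a^2^2"
  proof -
    have "act_poly g f2 = (cst (g$1$1) * cst (g$2$2) + cst (g$1$2) * cst (g$2$1))\<^sup>2 * f2"
      unfolding f2_eq act_poly_hom(1,2) act_poly_var_power_CARD[OF g] act_poly_var[OF g]
      by (simp add: char_2_simps)
    then show ?thesis
      by (simp add: det_cst[OF g])
  qed
  then show ?thesis
    by (simp add: invariant_ring_def)
qed

lemma f2_dvd_invariant:
  fixes h :: "'a poly3"
  assumes h: "h \<in> invariant_ring" and "var 3 dvd h"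
  shows "f2 dvd h"
proof -
  have "var 1 - cst e * var 3 dvd h" for e
  proof -
    obtain a where a: "a\<^sup>2 = e"
      using square_surj by blast
    \<comment> \<open>The first column (a, 1) sends x_3 to x_1 + a^2 x_3; every \<open>e\<close> is
      reached because it is a square.\<close>
    define g :: "'a^2^2" where "g = vector [vector [a, 1], vector [1, 0]]"
    have g: "g \<in> SL2"
      by (simp add: g_def SL2_def det_2 uminus_eq)
    have "act_poly g (var 3) dvd act_poly g h"
      using \<open>var 3 dvd h\<close> by (auto simp: dvd_def)
    moreover have "act_poly g (var 3) = var 1 - cst e * var 3"
      unfolding act_poly_var[OF g] by (simp add: g_def minus_eq_plus flip: a)
    ultimately show ?thesis
      using h g by (simp add: invariant_ring_def)
  qed
  then show ?thesis
    using dvd_of_linear_forms_dvd[OF \<open>var 3 dvd h\<close>] by (simp add: f2_eq minus_eq_plus)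
qed

section \<open>Differential forms by components\<close>

text \<open>The signs of the exterior product disappear in characteristic two.\<close>

lemma wedge_nth:
  "(\<eta> \<and>\<^sub>f \<theta>) $ K = (\<Sum>I\<in>Pow K. \<eta>$I * (\<theta>$(K - I) :: 'a poly3))"
  unfolding wedge_def uminus_eq by simp

lemma wedge_components:
  fixes \<eta> \<theta> :: "'a form"
  shows "(\<eta> \<and>\<^sub>f \<theta>) ${} = \<eta>${} * \<theta>${}"
    "(\<eta> \<and>\<^sub>f \<theta>) ${i} = \<eta>${} * \<theta>${i} + \<eta>${i} * \<theta>${}"
    "(\<eta> \<and>\<^sub>f \<theta>) ${1,2} = \<eta>${} * \<theta>${1,2} + \<eta>${1} * \<theta>${2} + \<eta>${2} * \<theta>${1} + \<eta>${1,2} * \<theta>${}"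
    "(\<eta> \<and>\<^sub>f \<theta>) ${1,3} = \<eta>${} * \<theta>${1,3} + \<eta>${1} * \<theta>${3} + \<eta>${3} * \<theta>${1} + \<eta>${1,3} * \<theta>${}"
    "(\<eta> \<and>\<^sub>f \<theta>) ${2,3} = \<eta>${} * \<theta>${2,3} + \<eta>${2} * \<theta>${3} + \<eta>${3} * \<theta>${2} + \<eta>${2,3} * \<theta>${}"
    "(\<eta> \<and>\<^sub>f \<theta>) ${1,2,3} = \<eta>${} * \<theta>${1,2,3} + \<eta>${1} * \<theta>${2,3} + \<eta>${2} * \<theta>${1,3} + \<eta>${3} * \<theta>${1,2}
      + \<eta>${1,2} * \<theta>${3} + \<eta>${1,3} * \<theta>${2} + \<eta>${2,3} * \<theta>${1} + \<eta>${1,2,3} * \<theta>${}"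
  by (simp_all add: wedge_nth Pow_insert doubleton_eq_iff insert_eq_iff insert_Diff_if
    insert_commute add_ac)

text \<open>In degree two the coefficients are the 2x2 minors of the action matrix, simplified by ad
  + bc = 1. The coefficient of dx_2 receives nothing from dx_1 and dx_3, so for an invariant form it
  is an invariant polynomial.\<close>

lemma act_form_components:
  fixes g :: "'a^2^2"
  assumes g: "g \<in> SL2"
  shows "act_form g \<eta> ${} = act_poly g (\<eta>${})"
    "act_form g \<eta> ${1} = (cst (g$2$2))\<^sup>2 * act_poly g (\<eta>${1})
      + cst (g$2$1) * cst (g$2$2) * act_poly g (\<eta>${2}) + (cst (g$2$1))\<^sup>2 * act_poly g (\<eta>${3})"
    "act_form g \<eta> ${2} = act_poly g (\<eta>${2})"
    "act_form g \<eta> ${3} = (cst (g$1$2))\<^sup>2 * act_poly g (\<eta>${1})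
      + cst (g$1$1) * cst (g$1$2) * act_poly g (\<eta>${2}) + (cst (g$1$1))\<^sup>2 * act_poly g (\<eta>${3})"
    "act_form g \<eta> ${1,2} = (cst (g$2$2))\<^sup>2 * act_poly g (\<eta>${1,2})
      + (cst (g$2$1))\<^sup>2 * act_poly g (\<eta>${2,3})"
    "act_form g \<eta> ${1,3} = cst (g$1$2) * cst (g$2$2) * act_poly g (\<eta>${1,2}) + act_poly g (\<eta>${1,3})
      + cst (g$1$1) * cst (g$2$1) * act_poly g (\<eta>${2,3})"
    "act_form g \<eta> ${2,3} = (cst (g$1$2))\<^sup>2 * act_poly g (\<eta>${1,2})
      + (cst (g$1$1))\<^sup>2 * act_poly g (\<eta>${2,3})"
    "act_form g \<eta> ${1,2,3} = act_poly g (\<eta>${1,2,3})"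
proof -
  define A B C D :: "'a poly3" where "A = cst (g$1$1)" "B = cst (g$1$2)" "C = cst (g$2$1)" "D
    = cst (g$2$2)"
  note ABCD = this
  have det: "A * D + B * C = 1"
    using det_cst[OF g] by (simp add: ABCD)
  have act_dx_nth: "act_dx g i ${} = 0"
    "act_dx g i ${j} = cst (dual_coeff g i j)" "act_dx g i ${1,2} = 0" "act_dx g i ${1,3} = 0"
      "act_dx g i ${2,3} = 0"
    "act_dx g i ${1,2,3} = 0" for i j
    using exhaust_3[of j] by (auto simp: act_dx_def sum_3 dx_nth doubleton_eq_iff insert_eq_iff)
  show "act_form g \<eta> ${} = act_poly g (\<eta>${})"
    "act_form g \<eta> ${1} = (cst (g$2$2))\<^sup>2 * act_poly g (\<eta>${1})
      + cst (g$2$1) * cst (g$2$2) * act_poly g (\<eta>${2}) + (cst (g$2$1))\<^sup>2 * act_poly g (\<eta>${3})"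
    "act_form g \<eta> ${2} = act_poly g (\<eta>${2})"
    "act_form g \<eta> ${3} = (cst (g$1$2))\<^sup>2 * act_poly g (\<eta>${1})
      + cst (g$1$1) * cst (g$1$2) * act_poly g (\<eta>${2}) + (cst (g$1$1))\<^sup>2 * act_poly g (\<eta>${3})"
    unfolding act_form_def sum_subsets_3 sorted_list_of_subsets_3
    by (simp_all add: wedge_components act_dx_nth one_form_nth dual_coeff_SL2[OF g])
  have "act_form g \<eta> ${1,2} = (D\<^sup>2 * act_poly g (\<eta>${1,2}) + C\<^sup>2 * act_poly g (\<eta>${2,3}))"
    unfolding act_form_def sum_subsets_3 sorted_list_of_subsets_3
    by (simp add: wedge_components act_dx_nth one_form_nth dual_coeff_SL2[OF g] ABCD)
  \<comment> \<open>Each minor occurring here contains the factor ad + bc, which is kept so that the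
    identity holds formally.\<close>
  moreover have "act_form g \<eta> ${1,3} = (A * D + B * C) * (B * D * act_poly g (\<eta>${1,2}) + (A * D
    + B * C) * act_poly g (\<eta>${1,3})
      + A * C * act_poly g (\<eta>${2,3}))"
    unfolding act_form_def sum_subsets_3 sorted_list_of_subsets_3
    by (simp add: wedge_components act_dx_nth one_form_nth dual_coeff_SL2[OF g] ABCD)
     (simp add: char_2_simps)
  moreover have "act_form g \<eta> ${2,3} = (B\<^sup>2 * act_poly g (\<eta>${1,2}) + A\<^sup>2 * act_poly g (\<eta>${2,3}))"
    unfolding act_form_def sum_subsets_3 sorted_list_of_subsets_3
    by (simp add: wedge_components act_dx_nth one_form_nth dual_coeff_SL2[OF g] ABCD)
  moreover have "act_form g \<eta> ${1,2,3} = (A * D + B * C)\<^sup>2 * act_poly g (\<eta>${1,2,3})"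
    unfolding act_form_def sum_subsets_3 sorted_list_of_subsets_3
    by (simp add: wedge_components act_dx_nth one_form_nth dual_coeff_SL2[OF g] ABCD)
     (simp add: char_2_simps)
  ultimately show "act_form g \<eta> ${1,2} = (cst (g$2$2))\<^sup>2 * act_poly g (\<eta>${1,2})
    + (cst (g$2$1))\<^sup>2 * act_poly g (\<eta>${2,3})"
    "act_form g \<eta> ${1,3} = cst (g$1$2) * cst (g$2$2) * act_poly g (\<eta>${1,2}) + act_poly g (\<eta>${1,3})
      + cst (g$1$1) * cst (g$2$1) * act_poly g (\<eta>${2,3})"
    "act_form g \<eta> ${2,3} = (cst (g$1$2))\<^sup>2 * act_poly g (\<eta>${1,2})
      + (cst (g$1$1))\<^sup>2 * act_poly g (\<eta>${2,3})"
    "act_form g \<eta> ${1,2,3} = act_poly g (\<eta>${1,2,3})"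
    unfolding det by (simp_all add: ABCD)
qed

text \<open>As q is even, the power is a square, and the derivative of a square is a multiple of
  2.\<close>

lemma partial_power_CARD: "partial i (f ^ CARD('a)) = (0 :: 'a poly3)"
proof -
  have "k \<noteq> 0"
  proof
    assume "k = 0"
    then show False
      using card card_mono[of "UNIV::'a set" "{0, 1}"] by simp
  qed
  then have "CARD('a) = 2 ^ (k - 1) + 2 ^ (k - 1)"
    using card by (cases k) simp_all
  then have "f ^ CARD('a) = f ^ 2 ^ (k - 1) * f ^ 2 ^ (k - 1)"
    by (simp add: power_add)
  then show ?thesis
    by (simp add: partial_mult mult.commute add_self)
qed

lemma partial_f1: "partial 1 f1 = (var 3 :: 'a poly3)" "partial 2 f1 = (0 :: 'a poly3)"
  "partial 3 f1 = (var 1 :: 'a poly3)"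
  unfolding f1_def minus_eq_plus power2_eq_square
  by (simp_all add: partial_add partial_mult partial_var add_self)

lemma partial_f2: "partial 1 f2 = (var 3 ^ CARD('a) :: 'a poly3)" "partial 2 f2 = (0 :: 'a poly3)"
   "partial 3 f2 = (var 1 ^ CARD('a) :: 'a poly3)"
  unfolding f2_eq
  by (simp_all add: partial_add partial_mult partial_var partial_power_CARD)

lemma f2_neq_0: "(f2 :: 'a poly3) \<noteq> 0"
proof
  assume "(f2 :: 'a poly3) = 0"
  then have "partial 1 f2 = (0 :: 'a poly3)"
    by (simp add: partial_def)
  then show False
    by (simp add: partial_f2)
qed

lemma omega_nth:
  "omega ${} = (0 :: 'a poly3)"
  "omega ${1} = (var 2 ^ CARD('a) * var 3 + var 2 * var 3 ^ CARD('a) :: 'a poly3)"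
  "omega ${2} = (f2 :: 'a poly3)"
  "omega ${3} = (var 1 ^ CARD('a) * var 2 + var 1 * var 2 ^ CARD('a) :: 'a poly3)"
  "omega ${1,2} = (0 :: 'a poly3)" "omega ${1,3} = (0 :: 'a poly3)" "omega ${2,3} = (0 :: 'a poly3)"
    "omega ${1,2,3} = (0 :: 'a poly3)"
  by (simp_all add: omega_def Let_def dx_nth doubleton_eq_iff insert_eq_iff f2_eq)

section \<open>Invariant forms\<close>

lemma invariant_forms_iff:
  "\<eta> \<in> invariant_forms \<longleftrightarrow> (\<forall>g\<in>SL2. act_poly g (\<eta>${}) = \<eta>${}
    \<and> (cst (g$2$2))\<^sup>2 * act_poly g (\<eta>${1})
      + cst (g$2$1) * cst (g$2$2) * act_poly g (\<eta>${2}) + (cst (g$2$1))\<^sup>2 * act_poly g (\<eta>${3}) = \<eta>${1}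
    \<and> act_poly g (\<eta>${2}) = \<eta>${2}
    \<and> (cst (g$1$2))\<^sup>2 * act_poly g (\<eta>${1})
      + cst (g$1$1) * cst (g$1$2) * act_poly g (\<eta>${2}) + (cst (g$1$1))\<^sup>2 * act_poly g (\<eta>${3}) = \<eta>${3}
    \<and> (cst (g$2$2))\<^sup>2 * act_poly g (\<eta>${1,2}) + (cst (g$2$1))\<^sup>2 * act_poly g (\<eta>${2,3}) = \<eta>${1,2}
    \<and> cst (g$1$2) * cst (g$2$2) * act_poly g (\<eta>${1,2}) + act_poly g (\<eta>${1,3})
      + cst (g$1$1) * cst (g$2$1) * act_poly g (\<eta>${2,3}) = \<eta>${1,3}
    \<and> (cst (g$1$2))\<^sup>2 * act_poly g (\<eta>${1,2}) + (cst (g$1$1))\<^sup>2 * act_poly g (\<eta>${2,3}) = \<eta>${2,3}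
    \<and> act_poly g (\<eta>${1,2,3}) = (\<eta>${1,2,3} :: 'a poly3))"
  unfolding invariant_forms_def mem_Collect_eq
  by (intro ball_cong refl) (simp only: form_eq_iff act_form_components)

text \<open>Cramer's rule for a system with determinant \<open>f2\<close>. The numerators pair (u,
  v) with (x_1, x_3) and with its q-th powers; these transform contragrediently to (u, v), so the
  numerators are invariant. They are divisible by x_3 because u is, hence by
  \<open>f2\<close>.\<close>

lemma invariant_pair_decomp:
  fixes u v :: "'a poly3"
  assumes inv: "\<And>g. g \<in> SL2 \<Longrightarrow> (cst (g$2$2))\<^sup>2 * act_poly g u + (cst (g$2$1))\<^sup>2 * act_poly g v = u"
      "\<And>g. g \<in> SL2 \<Longrightarrow> (cst (g$1$2))\<^sup>2 * act_poly g u + (cst (g$1$1))\<^sup>2 * act_poly g v = v"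
    and dvd: "var 3 dvd u"
  obtains c e where "c \<in> invariant_ring" "e \<in> invariant_ring"
    "u = c * var 3 + e * var 3 ^ CARD('a)" "v = c * var 1 + e * var 1 ^ CARD('a)"
proof -
  \<comment> \<open>These are the numerators for \<open>c\<close> and \<open>e\<close>
    respectively.\<close>
  define h1 h2 where "h1 = u * var 1 ^ CARD('a) + v * var 3 ^ CARD('a)" and "h2 = u * var 1 + v * var 3"
  have "act_poly g h1 = h1" "act_poly g h2 = h2" if g: "g \<in> SL2" for g
  proof -
    have "act_poly g h1 = ((cst (g$2$2))\<^sup>2 * act_poly g u
      + (cst (g$2$1))\<^sup>2 * act_poly g v) * var 1 ^ CARD('a)
       + ((cst (g$1$2))\<^sup>2 * act_poly g u + (cst (g$1$1))\<^sup>2 * act_poly g v) * var 3 ^ CARD('a)"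
      unfolding h1_def act_poly_hom(1,2) act_poly_var_power_CARD[OF g] by (simp add: algebra_simps)
    then show "act_poly g h1 = h1"
      by (simp add: inv[OF g] h1_def)
    have "act_poly g h2 = ((cst (g$2$2))\<^sup>2 * act_poly g u + (cst (g$2$1))\<^sup>2 * act_poly g v) * var 1
       + ((cst (g$1$2))\<^sup>2 * act_poly g u + (cst (g$1$1))\<^sup>2 * act_poly g v) * var 3"
      unfolding h2_def act_poly_hom(1,2) act_poly_var[OF g] by (simp add: algebra_simps)
    then show "act_poly g h2 = h2"
      by (simp add: inv[OF g] h2_def)
  qed
  then have h: "h1 \<in> invariant_ring" "h2 \<in> invariant_ring"
    by (simp_all add: invariant_ring_def)
  have "var 3 dvd h1" "var 3 dvd h2"
    using dvd by (simp_all add: h1_def h2_def dvd_power)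
  then obtain c e where ce: "h1 = f2 * c" "h2 = f2 * e"
    using f2_dvd_invariant h by (metis dvdE)
  show thesis
  proof
    show "c \<in> invariant_ring" "e \<in> invariant_ring"
      using h f2_neq_0 f2_invariant invariant_ring_cancel unfolding ce by blast+
    have "f2 * (c * var 3 + e * var 3 ^ CARD('a)) = h1 * var 3 + h2 * var 3 ^ CARD('a)"
      by (simp add: ce algebra_simps)
    also have "\<dots> = f2 * u"
      by (simp add: h1_def h2_def f2_eq char_2_simps)
    finally show "u = c * var 3 + e * var 3 ^ CARD('a)"
      using f2_neq_0 by simp
    have "f2 * (c * var 1 + e * var 1 ^ CARD('a)) = h1 * var 1 + h2 * var 1 ^ CARD('a)"
      by (simp add: ce algebra_simps)
    also have "\<dots> = f2 * v"
      by (simp add: h1_def h2_def f2_eq char_2_simps)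
    finally show "v = c * var 1 + e * var 1 ^ CARD('a)"
      using f2_neq_0 by simp
  qed
qed

lemma pair_decomp_unique:
  fixes c e c' e' :: "'a poly3"
  assumes 3: "c * var 3 + e * var 3 ^ CARD('a) = c' * var 3 + e' * var 3 ^ CARD('a)"
    and 1: "c * var 1 + e * var 1 ^ CARD('a) = c' * var 1 + e' * var 1 ^ CARD('a)"
  shows "c = c' \<and> e = e'"
proof
  have "f2 * c = (c * var 3 + e * var 3 ^ CARD('a)) * var 1 ^ CARD('a) + (c * var 1
    + e * var 1 ^ CARD('a)) * var 3 ^ CARD('a)" for c e :: "'a poly3"
    by (simp add: f2_eq char_2_simps)
  then have "f2 * c = f2 * c'"
    using assms by metis
  then show "c = c'"
    using f2_neq_0 by simp
  then show "e = e'"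
    using 1 by simp
qed

lemma vol_contraction_nth:
  fixes y :: "3 \<Rightarrow> 'a poly3"
  shows
  "vol_contraction y ${} = 0" "vol_contraction y ${i} = 0" "vol_contraction y ${1,2} = y 3"
  "vol_contraction y ${1,3} = y 2" "vol_contraction y ${2,3} = y 1" "vol_contraction y ${1,2,3} = 0"
  by (simp_all add: vol_contraction_def wedge_components dx_nth doubleton_eq_iff insert_eq_iff)

text \<open>Triples that transform like the coordinates, that is, equivariant linear maps from
  \<open>V\<^sup>*\<close> to R.\<close>

definition covariant :: "(3 \<Rightarrow> 'a poly3) \<Rightarrow> bool" where
  "covariant y \<longleftrightarrow> (\<forall>g\<in>SL2. act_poly g (y 1) = (cst (g$2$2))\<^sup>2 * y 1 + (cst (g$1$2))\<^sup>2 * y 3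
    \<and> act_poly g (y 2) = cst (g$2$1) * cst (g$2$2) * y 1 + y 2 + cst (g$1$1) * cst (g$1$2) * y 3
    \<and> act_poly g (y 3) = (cst (g$2$1))\<^sup>2 * y 1 + (cst (g$1$1))\<^sup>2 * y 3)"

lemma covariant_var: "covariant var" "covariant (\<lambda>i. var i ^ CARD('a))"
  using act_poly_var act_poly_var_power_CARD by (auto simp: covariant_def)

text \<open>These are the invariance conditions for a 2-form with coefficients \<open>y 3\<close>,
  \<open>y 2\<close>, \<open>y 1\<close>. The first and third are also those for the 1-form with
  coefficients \<open>y 3\<close>, 0, \<open>y 1\<close>, a shape shared by
  \<open>differential f1\<close> and \<open>differential f2\<close>.\<close>

lemma covariant_contragredient:
  assumes y: "covariant y" and g: "g \<in> SL2"
  shows "(cst (g$2$2))\<^sup>2 * act_poly g (y 3) + (cst (g$2$1))\<^sup>2 * act_poly g (y 1) = y 3"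
    "cst (g$1$2) * cst (g$2$2) * act_poly g (y 3) + act_poly g (y 2)
      + cst (g$1$1) * cst (g$2$1) * act_poly g (y 1) = y 2"
    "(cst (g$1$2))\<^sup>2 * act_poly g (y 3) + (cst (g$1$1))\<^sup>2 * act_poly g (y 1) = y 1"
proof -
  define A B C D :: "'a poly3" where "A = cst (g$1$1)" "B = cst (g$1$2)" "C = cst (g$2$1)" "D
    = cst (g$2$2)"
  note ABCD = this
  have det: "A * D + B * C = 1"
    using det_cst[OF g] by (simp add: ABCD)
  have act: "act_poly g (y 1) = D\<^sup>2 * y 1 + B\<^sup>2 * y 3"
    "act_poly g (y 2) = C * D * y 1 + y 2 + A * B * y 3"
    "act_poly g (y 3) = C\<^sup>2 * y 1 + A\<^sup>2 * y 3"
    using y g by (simp_all add: covariant_def ABCD)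
  \<comment> \<open>In the second identity the factor AD + BC + 1 is zero by
    \<open>det\<close>.\<close>
  have "D\<^sup>2 * act_poly g (y 3) + C\<^sup>2 * act_poly g (y 1) = (A * D + B * C)\<^sup>2 * y 3"
    "B * D * act_poly g (y 3) + act_poly g (y 2) + A * C * act_poly g (y 1)
      = y 2 + (A * D + B * C + 1) * (C * D * y 1 + A * B * y 3)"
    "B\<^sup>2 * act_poly g (y 3) + A\<^sup>2 * act_poly g (y 1) = (A * D + B * C)\<^sup>2 * y 1"
    by (simp_all add: act char_2_simps)
  then show "(cst (g$2$2))\<^sup>2 * act_poly g (y 3) + (cst (g$2$1))\<^sup>2 * act_poly g (y 1) = y 3"
    "cst (g$1$2) * cst (g$2$2) * act_poly g (y 3) + act_poly g (y 2)
      + cst (g$1$1) * cst (g$2$1) * act_poly g (y 1) = y 2"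
    "(cst (g$1$2))\<^sup>2 * act_poly g (y 3) + (cst (g$1$1))\<^sup>2 * act_poly g (y 1) = y 1"
    unfolding det by (simp_all add: add_self ABCD)
qed

lemma vol_contraction_invariant: "covariant y \<Longrightarrow> vol_contraction y \<in> invariant_forms"
  unfolding invariant_forms_iff by (simp add: vol_contraction_nth covariant_contragredient)

lemma differential_f1_invariant: "differential (f1 :: 'a poly3) \<in> invariant_forms"
  unfolding invariant_forms_iff
  using covariant_contragredient[OF covariant_var(1)]
  by (simp add: differential_nth partial_f1)

lemma differential_f2_invariant: "differential (f2 :: 'a poly3) \<in> invariant_forms"
  unfolding invariant_forms_iff
  using covariant_contragredient[OF covariant_var(2)]
  by (simp add: differential_nth partial_f2)

text \<open>The coefficients of \<open>omega\<close> are the 2x2 minors of the matrix whose rows are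
  the variables and their q-th powers. Both rows transform by the same matrix, of determinant
  one.\<close>

lemma omega_invariant: "(omega :: 'a form) \<in> invariant_forms"
  unfolding invariant_forms_iff
proof (intro ballI)
  fix g :: "'a^2^2"
  assume g: "g \<in> SL2"
  define A B C D :: "'a poly3" where "A = cst (g$1$1)" "B = cst (g$1$2)" "C = cst (g$2$1)" "D
    = cst (g$2$2)"
  note ABCD = this
  have det: "A * D + B * C = 1"
    using det_cst[OF g] by (simp add: ABCD)
  have f2: "act_poly g f2 = f2"
    using f2_invariant g by (simp add: invariant_ring_def)
  have act_omega:
    "act_poly g (omega ${1}) = (C * D * var 1 ^ CARD('a) + var 2 ^ CARD('a)
      + A * B * var 3 ^ CARD('a)) * (C\<^sup>2 * var 1 + A\<^sup>2 * var 3)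
      + (C * D * var 1 + var 2 + A * B * var 3) * (C\<^sup>2 * var 1 ^ CARD('a) + A\<^sup>2 * var 3 ^ CARD('a))"
    "act_poly g (omega ${3}) = (D\<^sup>2 * var 1 ^ CARD('a) + B\<^sup>2 * var 3 ^ CARD('a)) * (C * D * var 1
      + var 2 + A * B * var 3)
      + (D\<^sup>2 * var 1 + B\<^sup>2 * var 3) * (C * D * var 1 ^ CARD('a) + var 2 ^ CARD('a)
        + A * B * var 3 ^ CARD('a))"
    unfolding omega_nth act_poly_hom(1,2) act_poly_var_power_CARD[OF g] act_poly_var[OF g] ABCD by simp_all
  \<comment> \<open>The last summands vanish once AD + BC = 1; they make both identities
    formal.\<close>
  have "D\<^sup>2 * act_poly g (omega ${1}) + C * D * f2 + C\<^sup>2 * act_poly g (omega ${3})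
      = (A * D + B * C)\<^sup>2 * omega ${1} + ((A * D + B * C)\<^sup>2 + 1) * (C * D * f2)"
    "B\<^sup>2 * act_poly g (omega ${1}) + A * B * f2 + A\<^sup>2 * act_poly g (omega ${3})
      = (A * D + B * C)\<^sup>2 * omega ${3} + ((A * D + B * C)\<^sup>2 + 1) * (A * B * f2)"
    unfolding act_omega by (simp_all add: omega_nth f2_eq char_2_simps)
  then have "D\<^sup>2 * act_poly g (omega ${1}) + C * D * f2 + C\<^sup>2 * act_poly g (omega ${3}) = omega ${1}"
    "B\<^sup>2 * act_poly g (omega ${1}) + A * B * f2 + A\<^sup>2 * act_poly g (omega ${3}) = omega ${3}"
    unfolding det by (simp_all add: add_self)
  then show "act_poly g (omega ${}) = omega ${}
    \<and> (cst (g$2$2))\<^sup>2 * act_poly g (omega ${1})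
      + cst (g$2$1) * cst (g$2$2) * act_poly g (omega ${2})
        + (cst (g$2$1))\<^sup>2 * act_poly g (omega ${3}) = omega ${1}
    \<and> act_poly g (omega ${2}) = omega ${2}
    \<and> (cst (g$1$2))\<^sup>2 * act_poly g (omega ${1})
      + cst (g$1$1) * cst (g$1$2) * act_poly g (omega ${2})
        + (cst (g$1$1))\<^sup>2 * act_poly g (omega ${3}) = omega ${3}
    \<and> (cst (g$2$2))\<^sup>2 * act_poly g (omega ${1,2}) + (cst (g$2$1))\<^sup>2 * act_poly g (omega ${2,3})
      = omega ${1,2}
    \<and> cst (g$1$2) * cst (g$2$2) * act_poly g (omega ${1,2}) + act_poly g (omega ${1,3})
      + cst (g$1$1) * cst (g$2$1) * act_poly g (omega ${2,3}) = omega ${1,3}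
    \<and> (cst (g$1$2))\<^sup>2 * act_poly g (omega ${1,2}) + (cst (g$1$1))\<^sup>2 * act_poly g (omega ${2,3})
      = omega ${2,3}
    \<and> act_poly g (omega ${1,2,3}) = omega ${1,2,3}"
    by (simp only: omega_nth(1,3,5-8) f2 ABCD) simp
qed

lemma one_form_invariant: "(one_form :: 'a form) \<in> invariant_forms"
  unfolding invariant_forms_iff by (simp add: one_form_nth)

lemma wedge_dx_nth:
  "(dx 1 \<and>\<^sub>f dx 3) $ I = (if I = {1,3} then 1 else (0 :: 'a poly3))"
  "(dx 1 \<and>\<^sub>f dx 2 \<and>\<^sub>f dx 3) $ I = (if I = {1,2,3} then 1 else (0 :: 'a poly3))"
  using UNIV_I[of I] unfolding subsets_3
  by (auto simp: wedge_components dx_nth doubleton_eq_iff insert_eq_iff)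

text \<open>The action has determinant one on the span of x_1 and x_3, and also on the whole of
  \<open>V\<^sup>*\<close>.\<close>

lemma wedge_dx_invariant: "dx 1 \<and>\<^sub>f dx 3 \<in> (invariant_forms :: 'a form set)"
  "dx 1 \<and>\<^sub>f dx 2 \<and>\<^sub>f dx 3 \<in> (invariant_forms :: 'a form set)"
  unfolding invariant_forms_iff by (simp_all add: wedge_dx_nth doubleton_eq_iff insert_eq_iff)

text \<open>The matrix \<open>t b\<close> fixes x_3, adds b^2 x_3 to x_1 and b x_3 to x_2, so it
  acts trivially modulo x_3. The invariance equations for the coefficients at {1,3} and {3} then
  leave the stated terms divisible by x_3.\<close>

lemma transvection_dvd:
  assumes \<eta>: "\<eta> \<in> (invariant_forms :: 'a form set)"
  shows "var 3 dvd \<eta>${1,2}" "var 3 dvd (cst b)\<^sup>2 * \<eta>${1} + cst b * \<eta>${2}"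
proof -
  define t :: "'a \<Rightarrow> 'a^2^2" where "t b = vector [vector [1, b], vector [0, 1]]" for b
  have t: "t b \<in> SL2" for b
    by (simp add: t_def SL2_def det_2)
  have t_nth: "t b $ 1 $ 1 = 1" "t b $ 1 $ 2 = b" "t b $ 2 $ 1 = 0" "t b $ 2 $ 2 = 1" for b
    by (simp_all add: t_def)
  have "var 3 dvd subst_poly (\<lambda>i. \<Sum>j\<in>UNIV. cst (dual_coeff (t b) i j) * var j) f - subst_poly var f"
    for f b
  proof (rule dvd_subst_poly_diff)
    show "var 3 dvd (\<Sum>j\<in>UNIV. cst (dual_coeff (t b) i j) * var j) - var i" for i
      using exhaust_3[of i] dual_coeff_SL2[OF t, of b] by (auto simp: sum_3 t_nth)
  qed
  then have dvd: "var 3 dvd f - act_poly (t b) f" for f b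
    unfolding act_poly_def[symmetric] subst_poly_id by (simp only: minus_eq_plus add.commute)
  have inv: "act_poly (t b) (\<eta>${1}) = \<eta>${1}" "act_poly (t b) (\<eta>${2}) = \<eta>${2}"
    "act_poly (t b) (\<eta>${1,2}) = \<eta>${1,2}"
    "(cst b)\<^sup>2 * act_poly (t b) (\<eta>${1}) + cst b * act_poly (t b) (\<eta>${2}) + act_poly (t b) (\<eta>${3})
      = \<eta>${3}"
    "cst b * act_poly (t b) (\<eta>${1,2}) + act_poly (t b) (\<eta>${1,3}) = \<eta>${1,3}" for b
    using \<eta>[unfolded invariant_forms_iff, rule_format, OF t, of b] by (auto simp: t_nth)
  show "var 3 dvd \<eta>${1,2}"
    using dvd[of "\<eta>${1,3}" 1] inv(5)[of 1] by (simp add: inv(3) flip: eq_diff_eq)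
  show "var 3 dvd (cst b)\<^sup>2 * \<eta>${1} + cst b * \<eta>${2}"
    using dvd[of "\<eta>${3}" b] inv(4)[of b] by (simp add: inv(1,2) flip: eq_diff_eq)
qed

text \<open>A common criterion for both cases: \<open>w\<close> is \<open>omega\<close> for q > 2
  and the differential of \<open>f3\<close> for q = 2. The {1,3}-coefficients of \<open>B\<close>
  and \<open>C\<close> are left open, since multiples of dx_1 and dx_3 wedged together absorb
  them.\<close>

lemma freely_generated_invariant_forms:
  fixes w B C :: "'a form"
  assumes invariant: "w \<in> invariant_forms" "B \<in> invariant_forms" "C \<in> invariant_forms"
    and w: "w${} = 0" "w${1,2} = 0" "w${1,3} = 0" "w${2,3} = 0" "w${1,2,3} = 0" "w${2} \<noteq> 0"
    and w_dvd: "\<And>\<eta>. \<eta> \<in> invariant_forms \<Longrightarrow> w${2} dvd \<eta>${2}"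
    and B: "B${} = 0" "B${1} = 0" "B${2} = 0" "B${3} = 0" "B${1,2} = var 3" "B${2,3} = var 1"
      "B${1,2,3} = 0"
    and C: "C${} = 0" "C${1} = 0" "C${2} = 0" "C${3} = 0" "C${1,2} = var 3 ^ CARD('a)" "C${2,3}
      = var 1 ^ CARD('a)"
      "C${1,2,3} = 0"
  shows "freely_generated invariant_ring invariant_forms
    [one_form, differential f1, differential f2, w, dx 1 \<and>\<^sub>f dx 3, B, C, dx 1 \<and>\<^sub>f dx 2 \<and>\<^sub>f dx 3]"
proof -
  let ?bs = "[one_form, differential f1, differential f2, w, dx 1 \<and>\<^sub>f dx 3, B, C, dx 1 \<and>\<^sub>f dx 2 \<and>\<^sub>f dx 3]"
  let ?q = "CARD('a)"
  \<comment> \<open>In degrees one and two this is a 2x2 system of determinant \<open>f2\<close>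
    together with one further coordinate, \<open>c3\<close> or \<open>c4\<close>.\<close>
  have comb: "\<eta> = c0 *s one_form + c1 *s differential f1 + c2 *s differential f2 + c3 *s w
      + c4 *s (dx 1 \<and>\<^sub>f dx 3) + c5 *s B + c6 *s C + c7 *s (dx 1 \<and>\<^sub>f dx 2 \<and>\<^sub>f dx 3)
    \<longleftrightarrow> \<eta>${} = c0 \<and> \<eta>${1} = c1 * var 3 + c2 * var 3 ^ ?q + c3 * w${1} \<and> \<eta>${2} = c3 * w${2}
      \<and> \<eta>${3} = c1 * var 1 + c2 * var 1 ^ ?q + c3 * w${3} \<and> \<eta>${1,2} = c5 * var 3 + c6 * var 3 ^ ?q
      \<and> \<eta>${1,3} = c4 + c5 * B${1,3} + c6 * C${1,3} \<and> \<eta>${2,3} = c5 * var 1 + c6 * var 1 ^ ?q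
      \<and> \<eta>${1,2,3} = c7" for \<eta> c0 c1 c2 c3 c4 c5 c6 c7
    unfolding form_eq_iff
    by (simp add: one_form_nth differential_nth partial_f1 partial_f2 w B C wedge_dx_nth
      doubleton_eq_iff insert_eq_iff)
  have ex_coeffs: "\<exists>c0 c1 c2 c3 c4 c5 c6 c7. {c0, c1, c2, c3, c4, c5, c6, c7} \<subseteq> invariant_ring
    \<and> \<eta> = c0 *s one_form + c1 *s differential f1 + c2 *s differential f2 + c3 *s w
      + c4 *s (dx 1 \<and>\<^sub>f dx 3) + c5 *s B + c6 *s C + c7 *s (dx 1 \<and>\<^sub>f dx 2 \<and>\<^sub>f dx 3)"
    if \<eta>: "\<eta> \<in> invariant_forms" for \<eta>
  proof -
    have inv_nth: "\<theta>${} \<in> invariant_ring" "\<theta>${2} \<in> invariant_ring" "\<theta>${1,2,3} \<in> invariant_ring"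
      if "\<theta> \<in> invariant_forms" for \<theta> :: "'a form"
      using that unfolding invariant_forms_iff by (simp_all add: invariant_ring_def)
    obtain c3 where c3: "\<eta>${2} = c3 * w${2}"
      using w_dvd[OF \<eta>] by (metis dvdE mult.commute)
    have c3_inv: "c3 \<in> invariant_ring"
      using inv_nth(2)[OF \<eta>] inv_nth(2)[OF invariant(1)] w(6) invariant_ring_cancel
      unfolding c3 mult.commute[of c3] by blast
    \<comment> \<open>Addition is subtraction here: the dx_2-component is removed, after which the
      transvection with b = 1 gives divisibility of the dx_1-coefficient.\<close>
    define \<theta> where "\<theta> = \<eta> + c3 *s w"
    have \<theta>: "\<theta> \<in> invariant_forms"
      unfolding \<theta>_def by (intro invariant_forms_add invariant_forms_scale \<eta> c3_inv invariant)
    have \<theta>2: "\<theta>${2} = 0"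
      by (simp add: \<theta>_def c3 add_self)
    have "var 3 dvd \<theta>${1}"
      using transvection_dvd(2)[OF \<theta>, of 1] \<theta>2 by simp
    then obtain c1 c2 where c12: "c1 \<in> invariant_ring" "c2 \<in> invariant_ring"
      "\<theta>${1} = c1 * var 3 + c2 * var 3 ^ ?q" "\<theta>${3} = c1 * var 1 + c2 * var 1 ^ ?q"
      by (rule invariant_pair_decomp[rotated 2])
        (use \<theta>[unfolded invariant_forms_iff] \<theta>2 in auto)
    obtain c5 c6 where c56: "c5 \<in> invariant_ring" "c6 \<in> invariant_ring"
      "\<eta>${1,2} = c5 * var 3 + c6 * var 3 ^ ?q" "\<eta>${2,3} = c5 * var 1 + c6 * var 1 ^ ?q"
      by (rule invariant_pair_decomp[of "\<eta>${1,2}" "\<eta>${2,3}"])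
        (use \<eta>[unfolded invariant_forms_iff] transvection_dvd(1)[OF \<eta>] in auto)
    \<comment> \<open>After removal of \<open>B\<close> and \<open>C\<close> only the
      {1,3}-component remains in degree two. Without its two neighbours it is an invariant
      polynomial.\<close>
    define \<zeta> where "\<zeta> = \<eta> + c5 *s B + c6 *s C"
    have \<zeta>: "\<zeta> \<in> invariant_forms"
      unfolding \<zeta>_def by (intro invariant_forms_add invariant_forms_scale \<eta> c56 invariant)
    have "\<zeta>${1,2} = 0" "\<zeta>${2,3} = 0"
      by (simp_all add: \<zeta>_def B C c56 add_ac add_self add_self_left)
    then have c4: "\<zeta>${1,3} \<in> invariant_ring"
      using \<zeta> unfolding invariant_forms_iff by (simp add: invariant_ring_def)
    have "\<theta>${1} + c3 * w${1} = \<eta>${1}" "\<theta>${3} + c3 * w${3} = \<eta>${3}"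
      "\<zeta>${1,3} + c5 * B${1,3} + c6 * C${1,3} = \<eta>${1,3}"
      by (simp_all add: \<theta>_def \<zeta>_def add_ac add_self add_self_left)
    then have "\<eta> = \<eta>${} *s one_form + c1 *s differential f1 + c2 *s differential f2 + c3 *s w
      + \<zeta>${1,3} *s (dx 1 \<and>\<^sub>f dx 3) + c5 *s B + c6 *s C + \<eta>${1,2,3} *s (dx 1 \<and>\<^sub>f dx 2 \<and>\<^sub>f dx 3)"
      unfolding comb by (simp add: c12(3,4)[symmetric] c56(3,4) c3)
    moreover have "{\<eta>${}, c1, c2, c3, \<zeta>${1,3}, c5, c6, \<eta>${1,2,3}} \<subseteq> invariant_ring"
      using inv_nth[OF \<eta>] c12 c3_inv c4 c56 by simp
    ultimately show ?thesis
      by blast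
  qed
  have ex: "\<exists>cs. length cs = length ?bs \<and> set cs \<subseteq> invariant_ring \<and> \<eta>
    = (\<Sum>i<length ?bs. (cs ! i) *s (?bs ! i))"
    if \<eta>: "\<eta> \<in> invariant_forms" for \<eta>
  proof -
    obtain c0 c1 c2 c3 c4 c5 c6 c7 where "{c0, c1, c2, c3, c4, c5, c6, c7} \<subseteq> invariant_ring"
      "\<eta> = c0 *s one_form + c1 *s differential f1 + c2 *s differential f2 + c3 *s w
      + c4 *s (dx 1 \<and>\<^sub>f dx 3) + c5 *s B + c6 *s C + c7 *s (dx 1 \<and>\<^sub>f dx 2 \<and>\<^sub>f dx 3)"
      using ex_coeffs[OF \<eta>] by blast
    then have "length [c0, c1, c2, c3, c4, c5, c6, c7] = 8 \<and> set [c0, c1, c2, c3, c4, c5, c6, c7]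
      \<subseteq> invariant_ring \<and>
      \<eta> = (\<Sum>i<8. ([c0, c1, c2, c3, c4, c5, c6, c7] ! i) *s (?bs ! i))"
      unfolding sum_nth_8 by simp
    moreover have "length ?bs = 8"
      by simp
    ultimately show ?thesis
      by (intro exI[of _ "[c0, c1, c2, c3, c4, c5, c6, c7]"]) (simp only:)
  qed
  have unique: "cs = ds"
    if len: "length cs = length ?bs" "length ds = length ?bs"
      and eq: "(\<Sum>i<length ?bs. (cs ! i) *s (?bs ! i)) = (\<Sum>i<length ?bs. (ds ! i) *s (?bs ! i))"
        for cs ds
  proof -
    have bs: "length ?bs = 8"
      by simp
    obtain c0 c1 c2 c3 c4 c5 c6 c7 where cs: "cs = [c0, c1, c2, c3, c4, c5, c6, c7]"
      using len(1) unfolding bs list_8_conv by blast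
    obtain d0 d1 d2 d3 d4 d5 d6 d7 where ds: "ds = [d0, d1, d2, d3, d4, d5, d6, d7]"
      using len(2) unfolding bs list_8_conv by blast
    define \<eta> where "\<eta> = (\<Sum>i<8. (cs ! i) *s (?bs ! i))"
    have 1: "\<eta> = c0 *s one_form + c1 *s differential f1 + c2 *s differential f2 + c3 *s w
      + c4 *s (dx 1 \<and>\<^sub>f dx 3) + c5 *s B + c6 *s C + c7 *s (dx 1 \<and>\<^sub>f dx 2 \<and>\<^sub>f dx 3)"
      unfolding \<eta>_def cs sum_nth_8 ..
    have 2: "\<eta> = d0 *s one_form + d1 *s differential f1 + d2 *s differential f2 + d3 *s w
      + d4 *s (dx 1 \<and>\<^sub>f dx 3) + d5 *s B + d6 *s C + d7 *s (dx 1 \<and>\<^sub>f dx 2 \<and>\<^sub>f dx 3)"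
      unfolding \<eta>_def eq[unfolded bs] ds sum_nth_8 ..
    note 1 = 1[unfolded comb] and 2 = 2[unfolded comb]
    \<comment> \<open>The system is triangular: \<open>c3\<close> is read off first, both 2x2
      systems have unique solutions, and \<open>c4\<close> follows from \<open>c5\<close> and
      \<open>c6\<close>.\<close>
    have "c3 = d3"
      using 1 2 w(6) by (metis mult_right_cancel)
    moreover have "c1 = d1 \<and> c2 = d2"
      using 1 2 \<open>c3 = d3\<close> by (intro pair_decomp_unique) (metis add_right_cancel)+
    moreover have "c5 = d5 \<and> c6 = d6"
      using 1 2 by (intro pair_decomp_unique) metis+
    moreover have "c4 = d4"
      using 1 2 \<open>c5 = d5 \<and> c6 = d6\<close> by (metis add_right_cancel)
    ultimately show ?thesis
      using 1 2 by (simp add: cs ds)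
  qed
  have "0 \<in> (invariant_forms :: 'a form set)"
    by (simp add: invariant_forms_iff)
  then show ?thesis
    unfolding freely_generated_def
    using invariant_forms_add invariant_forms_scale one_form_invariant differential_f1_invariant
      differential_f2_invariant
      wedge_dx_invariant invariant ex unique
    by (auto intro!: ex_ex1I)
qed

section \<open>Division by \<open>f2\<close>\<close>

lemma form_quotient_eq:
  assumes "f2 *s \<xi> = (\<eta> :: 'a form)"
  shows "\<exists>!\<xi>. f2 *s \<xi> = \<eta>" "form_quotient f2 \<eta> = \<xi>"
proof -
  have "\<xi>' = \<xi>" if "f2 *s \<xi>' = \<eta>" for \<xi>'
    using that f2_neq_0 unfolding assms[symmetric] by (simp add: vec_eq_iff)
  then show "\<exists>!\<xi>. f2 *s \<xi> = \<eta>" "form_quotient f2 \<eta> = \<xi>"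
    unfolding form_quotient_def using assms by blast+
qed

text \<open>The dx_2-coefficient of \<open>omega\<close> is \<open>f2\<close>, which yields the
  coefficients at {1,2} and {2,3}. At {1,3} the terms regroup into a multiple of
  \<open>f2\<close>.\<close>

lemma wedge_differentials:
  "f2 *s (dx 1 \<and>\<^sub>f dx 3) = differential f1 \<and>\<^sub>f differential (f2 :: 'a poly3)"
  "f2 *s vol_contraction var = differential f1 \<and>\<^sub>f (omega :: 'a form)"
  "f2 *s vol_contraction (\<lambda>i. var i ^ CARD('a)) = differential f2 \<and>\<^sub>f (omega :: 'a form)"
  unfolding form_eq_iff
  by (simp_all add: wedge_components differential_nth partial_f1 partial_f2 dx_nth omega_nth vol_contraction_nth
    doubleton_eq_iff insert_eq_iff)
    (simp_all add: f2_eq char_2_simps)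

text \<open>For q > 2 there is a scalar b other than 0 and 1. The transvections for b and 1 give two
  relations modulo x_3, from which \<open>\<eta>${1}\<close> is eliminated; the remaining factor b(1
  + b) is invertible.\<close>

lemma f2_dvd_invariant_form_nth:
  assumes q: "CARD('a) > 2" and \<eta>: "\<eta> \<in> (invariant_forms :: 'a form set)"
  shows "f2 dvd \<eta>${2}"
proof -
  have "{0, 1} \<noteq> (UNIV :: 'a set)"
  proof
    assume "{0, 1} = (UNIV :: 'a set)"
    then have "CARD('a) = card {0, 1 :: 'a}"
      by simp
    then show False
      using q by simp
  qed
  then obtain b :: 'a where b: "b \<noteq> 0" "b \<noteq> 1"
    by blast
  have "var 3 dvd ((cst b)\<^sup>2 * \<eta>${1} + cst b * \<eta>${2}) + (cst b)\<^sup>2 * (\<eta>${1} + \<eta>${2})"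
    using transvection_dvd(2)[OF \<eta>, of b] transvection_dvd(2)[OF \<eta>, of 1] by simp
  also have "((cst b)\<^sup>2 * \<eta>${1} + cst b * \<eta>${2}) + (cst b)\<^sup>2 * (\<eta>${1} + \<eta>${2}) = cst (b * (1
    + b)) * \<eta>${2}"
    by (simp add: char_2_simps)
  finally have "var 3 dvd cst (b * (1 + b)) * \<eta>${2}" .
  then have "var 3 dvd cst (inverse (b * (1 + b))) * cst (b * (1 + b)) * \<eta>${2}"
    unfolding mult.assoc by (rule dvd_mult)
  moreover have "b * (1 + b) \<noteq> 0"
    using b by (simp add: eq_iff_diff_eq_0[of b 1] minus_eq_plus add.commute)
  then have "cst (inverse (b * (1 + b))) * cst (b * (1 + b)) = 1"
    by (metis cst_hom(2,4) left_inverse)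
  ultimately have "var 3 dvd \<eta>${2}"
    by simp
  moreover have "\<eta>${2} \<in> invariant_ring"
    using \<eta> unfolding invariant_forms_iff by (simp add: invariant_ring_def)
  ultimately show ?thesis
    by (simp add: f2_dvd_invariant)
qed

section \<open>The field with two elements\<close>

text \<open>Over two elements the form x^2 + xy + y^2 takes the value 1 at every nonzero vector, and
  the rows of an invertible matrix are nonzero.\<close>

lemma linear_form_coeffs:
  assumes "CARD('a) = 2" and g: "g \<in> SL2"
  shows "(cst (g$2$2))\<^sup>2 + cst (g$2$1) * cst (g$2$2) + (cst (g$2$1))\<^sup>2 = (1 :: 'a poly3)"
    "(cst (g$1$2))\<^sup>2 + cst (g$1$1) * cst (g$1$2) + (cst (g$1$1))\<^sup>2 = (1 :: 'a poly3)"
proof -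
  have "{0, 1} = (UNIV :: 'a set)"
    by (rule card_subset_eq) (simp_all add: assms)
  then have "x = 0 \<or> x = 1" for x :: 'a
    by (metis UNIV_I empty_iff insert_iff)
  from this[of "g$1$1"] this[of "g$1$2"] this[of "g$2$1"] this[of "g$2$2"]
  show "(cst (g$2$2))\<^sup>2 + cst (g$2$1) * cst (g$2$2) + (cst (g$2$1))\<^sup>2 = (1 :: 'a poly3)"
    "(cst (g$1$2))\<^sup>2 + cst (g$1$1) * cst (g$1$2) + (cst (g$1$1))\<^sup>2 = (1 :: 'a poly3)"
    using det_cst[OF g] by (auto simp: add_self)
qed

lemma linear_form_invariant:
  assumes "CARD('a) = 2"
  shows "var 1 + var 2 + var 3 \<in> (invariant_ring :: 'a poly3 set)"
proof -
  have "act_poly g (var 1 + var 2 + var 3) = var 1 + var 2 + var 3" if g: "g \<in> SL2" for g :: "'a^2^2"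
  proof -
    have "act_poly g (var 1 + var 2 + var 3) = ((cst (g$2$2))\<^sup>2 + cst (g$2$1) * cst (g$2$2)
      + (cst (g$2$1))\<^sup>2) * var 1
        + var 2 + ((cst (g$1$2))\<^sup>2 + cst (g$1$1) * cst (g$1$2) + (cst (g$1$1))\<^sup>2) * var 3"
      by (simp add: act_poly_var[OF g] algebra_simps)
    then show ?thesis
      unfolding linear_form_coeffs[OF assms g] by simp
  qed
  then show ?thesis
    by (simp add: invariant_ring_def)
qed

text \<open>The only irreducible quadratic over two elements is x^2 + x + 1, and it makes both
  factors of \<open>f3_tilde\<close> equal to the same linear form.\<close>

lemma f3_eq:
  fixes \<gamma> \<delta> :: 'a
  assumes q: "CARD('a) = 2" and irred: "irreducible [:- \<delta>, - \<gamma>, 1:]"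
  shows "f3 \<gamma> \<delta> = var 1 + var 2 + var 3"
proof -
  let ?p = "[:- \<delta>, - \<gamma>, 1:]"
  have UNIV: "UNIV = {0, 1 :: 'a}"
    by (rule card_subset_eq[symmetric]) (simp_all add: q)
  then have el: "x = 0 \<or> x = 1" for x :: 'a
    by (metis UNIV_I empty_iff insert_iff)
  \<comment> \<open>An irreducible quadratic has no root, and 1 is the only nonzero value.\<close>
  have root: "poly ?p c = 1" for c
  proof -
    have "poly ?p c \<noteq> 0"
    proof
      assume "poly ?p c = 0"
      then obtain r where r: "?p = [:- c, 1:] * r"
        by (metis dvdE poly_eq_0_iff_dvd)
      then have "is_unit r"
        using irred irreducibleD[of ?p "[:- c, 1:]" r] by (auto simp: is_unit_poly_iff)
      then have "degree ?p \<le> 1"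
        unfolding r by (auto simp: is_unit_poly_iff)
      then show False
        by simp
    qed
    then show ?thesis
      using el by blast
  qed
  have "poly ?p 0 = 1" "poly ?p 1 = 1"
    by (rule root)+
  then have "\<delta> = 1" "\<gamma> = 1"
    using el[of \<gamma>] el[of \<delta>] by (auto simp: uminus_eq add_self)
  have "f3_tilde \<gamma> \<delta> = (\<Prod>\<alpha>\<in>(UNIV :: 'a set). var 1 + var 2 + var 3)"
    unfolding f3_tilde_def
  proof (intro prod.cong refl)
    fix \<alpha> :: 'a
    have "UNIV - {0::'a} = {1}"
      unfolding UNIV by auto
    show "(\<Prod>\<beta>\<in>UNIV - {0}. var 1 - cst ((2 * \<alpha> - \<gamma>) / \<beta>) * var 2 + cst (poly ?p \<alpha> / \<beta>\<^sup>2) * var 3)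
        = var 1 + var 2 + var 3"
      unfolding \<open>UNIV - {0} = {1}\<close> root by (simp add: two_eq_0 \<open>\<gamma> = 1\<close>)
  qed
  then have tilde: "f3_tilde \<gamma> \<delta> = (var 1 + var 2 + var 3)\<^sup>2"
    by (simp add: q)
  show ?thesis
    unfolding f3_def tilde
  proof (rule the_equality)
    fix f :: "'a poly3"
    assume "f \<in> invariant_ring \<and> f\<^sup>2 = (var 1 + var 2 + var 3)\<^sup>2"
    then have "f = var 1 + var 2 + var 3 \<or> f = - (var 1 + var 2 + var 3)"
      by (simp only: power2_eq_iff)
    then show "f = var 1 + var 2 + var 3"
      unfolding uminus_eq by blast
  qed (simp add: linear_form_invariant q)
qed

lemma differential_linear_form_nth:
  "differential (var 1 + var 2 + var 3 :: 'a poly3) ${i} = 1"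
  using exhaust_3[of i] by (auto simp: differential_nth partial_add partial_var)

lemma differential_linear_form_invariant:
  assumes "CARD('a) = 2"
  shows "differential (var 1 + var 2 + var 3) \<in> (invariant_forms :: 'a form set)"
  unfolding invariant_forms_iff
  using linear_form_coeffs[OF assms] by (simp add: differential_linear_form_nth differential_nth(2-))

end

theorem theorem1p3:
  fixes \<gamma> \<delta> :: "'a::{field,finite}" and k :: nat
  assumes "CARD('a) = 2 ^ k"
    and "irreducible [:- \<delta>, - \<gamma>, 1:]"
  shows "let df1 = differential (f1 :: 'a poly3);
             df2 = differential (f2 :: 'a poly3);
             df3 = differential (f3 \<gamma> \<delta>)
    in (CARD('a) > 2 \<longrightarrow>
       (\<forall>\<eta> \<in> {df1 \<and>\<^sub>f df2, df1 \<and>\<^sub>f omega, df2 \<and>\<^sub>f omega}. \<exists>!\<xi>. f2 *s \<xi> = \<eta>) \<and>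
       freely_generated invariant_ring invariant_forms
         [one_form, df1, df2, omega,
          form_quotient f2 (df1 \<and>\<^sub>f df2), form_quotient f2 (df1 \<and>\<^sub>f omega),
          form_quotient f2 (df2 \<and>\<^sub>f omega),
          dx 1 \<and>\<^sub>f dx 2 \<and>\<^sub>f dx 3])
    \<and> (CARD('a) = 2 \<longrightarrow>
       (\<exists>!\<xi>. f2 *s \<xi> = df1 \<and>\<^sub>f df2) \<and>
       freely_generated invariant_ring invariant_forms
         [one_form, df1, df2, df3,
          form_quotient f2 (df1 \<and>\<^sub>f df2), df1 \<and>\<^sub>f df3, df2 \<and>\<^sub>f df3,
          dx 1 \<and>\<^sub>f dx 2 \<and>\<^sub>f dx 3])"
proof -
  note card = assms(1)
  note quot = wedge_differentials[OF card, THEN form_quotient_eq(1)[OF card]]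
    wedge_differentials[OF card, THEN form_quotient_eq(2)[OF card]]
  \<comment> \<open>The criterion applies with \<open>w = omega\<close>, whose dx_2-coefficient
    \<open>f2\<close> divides that of every invariant form when q > 2.\<close>
  have gt: "freely_generated invariant_ring invariant_forms
         [one_form, differential f1, differential f2, omega, dx 1 \<and>\<^sub>f dx 3, vol_contraction var,
          vol_contraction (\<lambda>i. var i ^ CARD('a)), dx 1 \<and>\<^sub>f dx 2 \<and>\<^sub>f (dx 3 :: 'a form)]"
            if "CARD('a) > 2"
    by (rule freely_generated_invariant_forms[OF card])
      (simp_all add: omega_nth[OF card] vol_contraction_nth[OF card] omega_invariant[OF card] f2_neq_0[OF card]
        vol_contraction_invariant[OF card] covariant_var[OF card] f2_dvd_invariant_form_nth[OF card that])
  have eq: "freely_generated invariant_ring invariant_forms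
         [one_form, differential f1, differential f2, differential (f3 \<gamma> \<delta>), dx 1 \<and>\<^sub>f dx 3,
          differential f1 \<and>\<^sub>f differential (f3 \<gamma> \<delta>), differential f2 \<and>\<^sub>f differential (f3 \<gamma> \<delta>),
          dx 1 \<and>\<^sub>f dx 2 \<and>\<^sub>f dx 3]" if q: "CARD('a) = 2"
  proof -
    let ?s = "var 1 + var 2 + var 3 :: 'a poly3"
    \<comment> \<open>The wedge products differ from the contractions only at {1,3}, so they can
      serve as \<open>B\<close> and \<open>C\<close>. Here \<open>w\<close> has dx_2-coefficient 1,
      which makes the divisibility condition trivial.\<close>
    have wedges: "differential f1 \<and>\<^sub>f differential ?s = vol_contraction var + ?s *s (dx 1 \<and>\<^sub>f dx 3)"
      "differential f2 \<and>\<^sub>f differential ?s = vol_contraction (\<lambda>i. var i ^ CARD('a))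
        + ?s\<^sup>2 *s (dx 1 \<and>\<^sub>f dx 3)"
      unfolding form_eq_iff
      by (simp_all add: wedge_components[OF card] differential_linear_form_nth[OF card]
        differential_nth(2-)
          differential_nth(1)[of f1] differential_nth(1)[of f2] partial_f1[OF card] partial_f2[OF card]
          vol_contraction_nth[OF card] dx_nth doubleton_eq_iff insert_eq_iff)
        (simp_all add: q char_2_simps[OF card] two_eq_0[OF card])
    have s: "?s \<in> invariant_ring" "?s\<^sup>2 \<in> invariant_ring"
      using linear_form_invariant[OF card q] by (simp_all add: invariant_ring_def)
    have "differential f1 \<and>\<^sub>f differential ?s \<in> invariant_forms"
      "differential f2 \<and>\<^sub>f differential ?s \<in> invariant_forms"
      unfolding wedges
      by (intro invariant_forms_add invariant_forms_scale s vol_contraction_invariant[OF card] covariant_var[OF card]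
          wedge_dx_invariant[OF card])+
    then show ?thesis
      unfolding f3_eq[OF card q assms(2)]
      by (intro freely_generated_invariant_forms[OF card] differential_linear_form_invariant[OF card q])
        (simp_all add: wedge_components[OF card] differential_linear_form_nth[OF card]
          differential_nth(2-) differential_nth(1)[of f1] differential_nth(1)[of f2]
          partial_f1[OF card] partial_f2[OF card])
  qed
  show ?thesis
    using gt eq by (simp add: quot Let_def)
qed

end
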